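(* Let $H$ be a separable Hilbert space, $1\le p<\infty$, and $S$ a compact operator on $H$. The following are equivalent: (a) $S\in S_p$; (b) $\{\langle Se_n,e_n\rangle\}\in\ell^p$ for every orthonormal basis $\{e_n\}$ of $H$; (c) $\{\langle Sf_n,f_n\rangle\}\in\ell^p$ for every frame $\{f_n\}$ of $H$. Furthermore, if $S$ is self-adjoint, then $$\|S\|_p^p=\sup\sum_{n=1}^\infty|\langle Se_n,e_n\rangle|^p=\sup\sum_{n=1}^\infty|\langle Sf_n,f_n\rangle|^p,$$ where the first supremum is over all orthonormal bases and the second over all frames with upper frame bound at most $1$.
   Context: A sequence $\{f_n\}$ in $H$ is a frame if there are constants $0<C_1\le C_2$ such that $C_1\|f\|^2\le\sum_n|\langle f,f_n\rangle|^2\le C_2\|f\|^2$ for all $f\in H$. The upper frame bound is the infimum of all admissible $C_2$. For a compact operator $T$, its singular values $\lambda_1\ge\lambda_2\ge\cdots$ are the positive eigenvalues of $(T^*T)^{1/2}$, repeated according to multiplicity. For $0<p<\infty$, $S_p$ is the set of compact $T$ with $\{\lambda_n\}\in\ell^p$, and $\|T\|_p=(\sum_n\lambda_n^p)^{1/p}$. *)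

theory Defs
  imports "HOL-Analysis.Analysis"
begin

class chilbert = banach +
  fixes scaleC :: "complex \<Rightarrow> 'a \<Rightarrow> 'a"
    and cinner :: "'a \<Rightarrow> 'a \<Rightarrow> complex"
  assumes scaleC_scaleR: "scaleC (complex_of_real r) x = scaleR r x"
    and scaleC_add_right: "scaleC a (x + y) = scaleC a x + scaleC a y"
    and scaleC_add_left: "scaleC (a + b) x = scaleC a x + scaleC b x"
    and scaleC_scaleC: "scaleC a (scaleC b x) = scaleC (a * b) x"
    and cinner_commute: "cinner x y = cnj (cinner y x)"
    and cinner_add_left: "cinner (x + y) z = cinner x z + cinner y z"
    and cinner_scaleC_left: "cinner (scaleC a x) y = a * cinner x y"
    and cinner_norm: "cinner x x = complex_of_real ((norm x)^2)"

definition separable :: "'a::chilbert itself \<Rightarrow> bool" where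
  "separable _ \<longleftrightarrow> (\<exists>D::'a set. countable D \<and> closure D = UNIV)"

definition clinear_op :: "('a::chilbert \<Rightarrow> 'a) \<Rightarrow> bool" where
  "clinear_op T \<longleftrightarrow> (\<forall>x y. T (x + y) = T x + T y) \<and> (\<forall>c x. T (scaleC c x) = scaleC c (T x))"

definition bounded_op :: "('a::chilbert \<Rightarrow> 'a) \<Rightarrow> bool" where
  "bounded_op T \<longleftrightarrow> clinear_op T \<and> (\<exists>K. \<forall>x. norm (T x) \<le> K * norm x)"

definition compact_op :: "('a::chilbert \<Rightarrow> 'a) \<Rightarrow> bool" where
  "compact_op T \<longleftrightarrow> clinear_op T \<and> compact (closure (T ` cball 0 1))"

definition self_adjoint :: "('a::chilbert \<Rightarrow> 'a) \<Rightarrow> bool" where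
  "self_adjoint T \<longleftrightarrow> (\<forall>x y. cinner (T x) y = cinner x (T y))"

definition adjoint :: "('a::chilbert \<Rightarrow> 'a) \<Rightarrow> ('a \<Rightarrow> 'a)" where
  "adjoint T = (THE T'. \<forall>x y. cinner (T x) y = cinner x (T' y))"

definition positive_op :: "('a::chilbert \<Rightarrow> 'a) \<Rightarrow> bool" where
  "positive_op T \<longleftrightarrow> bounded_op T \<and> (\<forall>x. Im (cinner (T x) x) = 0 \<and> Re (cinner (T x) x) \<ge> 0)"

definition abs_op :: "('a::chilbert \<Rightarrow> 'a) \<Rightarrow> ('a \<Rightarrow> 'a)" where
  "abs_op T = (THE R. positive_op R \<and> (\<forall>x. R (R x) = adjoint T (T x)))"

definition orthonormal :: "'a::chilbert set \<Rightarrow> bool" where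
  "orthonormal B \<longleftrightarrow> (\<forall>x\<in>B. cinner x x = 1) \<and> (\<forall>x\<in>B. \<forall>y\<in>B. x \<noteq> y \<longrightarrow> cinner x y = 0)"

definition onb :: "'a::chilbert set \<Rightarrow> bool" where
  "onb E \<longleftrightarrow> orthonormal E \<and> (\<forall>x. (\<forall>e\<in>E. cinner x e = 0) \<longrightarrow> x = 0)"

definition hdim :: "'a::chilbert set \<Rightarrow> ennreal" where
  "hdim V = (SUP B\<in>{B. finite B \<and> B \<subseteq> V \<and> orthonormal B}. of_nat (card B))"

definition eigenspace :: "('a::chilbert \<Rightarrow> 'a) \<Rightarrow> complex \<Rightarrow> 'a set" where
  "eigenspace T \<mu> = {x. T x = scaleC \<mu> x}"

definition singular_value_set :: "('a::chilbert \<Rightarrow> 'a) \<Rightarrow> real set" where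
  "singular_value_set T = {s. s > 0 \<and> eigenspace (abs_op T) (complex_of_real s) \<noteq> {0}}"

text \<open>schatten_pow p T = sum over singular values lambda_n (with multiplicity) of lambda_n^p,
  i.e. the quantity ||T||_p^p, valued in [0,\<infinity>].\<close>
definition schatten_pow :: "real \<Rightarrow> ('a::chilbert \<Rightarrow> 'a) \<Rightarrow> ennreal" where
  "schatten_pow p T = (\<Sum>\<^sub>\<infinity>s\<in>singular_value_set T.
      hdim (eigenspace (abs_op T) (complex_of_real s)) * ennreal (s powr p))"

definition in_Sp :: "real \<Rightarrow> ('a::chilbert \<Rightarrow> 'a) \<Rightarrow> bool" where
  "in_Sp p T \<longleftrightarrow> compact_op T \<and> schatten_pow p T < top"

definition frame_bounds :: "(nat \<Rightarrow> 'a::chilbert) \<Rightarrow> real \<Rightarrow> real \<Rightarrow> bool" where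
  "frame_bounds f C1 C2 \<longleftrightarrow> 0 < C1 \<and> C1 \<le> C2 \<and>
     (\<forall>x. summable (\<lambda>n. (cmod (cinner x (f n)))^2) \<and>
          C1 * (norm x)^2 \<le> (\<Sum>n. (cmod (cinner x (f n)))^2) \<and>
          (\<Sum>n. (cmod (cinner x (f n)))^2) \<le> C2 * (norm x)^2)"

definition frame :: "(nat \<Rightarrow> 'a::chilbert) \<Rightarrow> bool" where
  "frame f \<longleftrightarrow> (\<exists>C1 C2. frame_bounds f C1 C2)"

definition upper_frame_bound :: "(nat \<Rightarrow> 'a::chilbert) \<Rightarrow> real" where
  "upper_frame_bound f = Inf {C2. \<exists>C1. frame_bounds f C1 C2}"

end

theory Submission
  imports Defs
begin

text \<open>
  Let \<open>e\<close> range over an orthonormal eigenbasis of \<open>S\<^sup>* S\<close>, so that the singular values are the \<open>\<sigma>\<^sub>e = \<parallel>S e\<parallel>\<close>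
  and \<open>S e = \<sigma>\<^sub>e v\<^sub>e\<close> with \<open>v\<close> orthonormal where \<open>\<sigma>\<^sub>e > 0\<close>. For Bessel sequences \<open>f, g\<close> with bound \<open>C\<close>,
  AM-GM gives \<open>\<bar>\<langle>S f\<^sub>n, g\<^sub>n\<rangle>\<bar> \<le> \<Sum>\<^sub>e \<sigma>\<^sub>e w\<^sub>n\<^sub>e\<close> with weights
  \<open>w\<^sub>n\<^sub>e = (\<bar>\<langle>f\<^sub>n, e\<rangle>\<bar>\<^sup>2 + \<bar>\<langle>g\<^sub>n, v\<^sub>e\<rangle>\<bar>\<^sup>2) / 2\<close> whose row and column sums are at most \<open>C\<close>, and convexity of
  the \<open>p\<close>-th power yields \<open>\<Sum>\<^sub>n \<bar>\<langle>S f\<^sub>n, g\<^sub>n\<rangle>\<bar>\<^sup>p \<le> C\<^sup>p \<Sum>\<^sub>e \<sigma>\<^sub>e\<^sup>p\<close>. With \<open>g = f\<close> this is (a) \<open>\<Rightarrow>\<close> (c) and the upper bound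
  for both suprema; an eigenbasis of a self-adjoint \<open>S\<close> attains equality. An orthonormal basis is a
  frame with bounds \<open>1\<close>, whence (c) \<open>\<Rightarrow>\<close> (b). For (b) \<open>\<Rightarrow>\<close> (a), the eigenbases of the real and
  imaginary parts \<open>A, B\<close> of \<open>S\<close> show that these lie in the Schatten class, and then
  \<open>\<sigma>\<^sub>e = \<langle>S e, v\<^sub>e\<rangle> = \<langle>A e, v\<^sub>e\<rangle> + \<i> \<langle>B e, v\<^sub>e\<rangle>\<close> is bounded by the inequality above for \<open>A\<close> and \<open>B\<close>.
\<close>

section \<open>Inner products and orthonormal expansions\<close>

lemma scaleC_one: "scaleC 1 x = (x::'a::chilbert)"
  using scaleC_scaleR[of 1 x] by simp

lemma scaleC_zero_left: "scaleC 0 x = (0::'a::chilbert)"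
  using scaleC_scaleR[of 0 x] by simp

lemma scaleC_zero_right: "scaleC a 0 = (0::'a::chilbert)"
  using scaleC_add_right[of a 0 "0::'a"] by simp

lemma scaleC_minus_left: "scaleC (- a) x = - scaleC a (x::'a::chilbert)"
  using scaleC_add_left[of a "- a" x] by (simp add: scaleC_zero_left add_eq_0_iff)

lemma scaleC_minus_right: "scaleC a (- x) = - scaleC a (x::'a::chilbert)"
  using scaleC_add_right[of a x "- x"] by (simp add: scaleC_zero_right add_eq_0_iff)

lemma scaleC_diff_right: "scaleC a (x - y) = scaleC a x - scaleC a (y::'a::chilbert)"
  using scaleC_add_right[of a x "- y"] by (simp add: scaleC_minus_right)

lemma cinner_zero_left [simp]: "cinner 0 (x::'a::chilbert) = 0"
  using cinner_add_left[of 0 "0::'a" x] by simp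

lemma cinner_zero_right [simp]: "cinner (x::'a::chilbert) 0 = 0"
  using cinner_commute[of x 0] by simp

lemma cinner_add_right: "cinner (x::'a::chilbert) (y + z) = cinner x y + cinner x z"
  using cinner_add_left[of y z x] by (metis cinner_commute complex_cnj_add)

lemma cinner_scaleC_right: "cinner (x::'a::chilbert) (scaleC a y) = cnj a * cinner x y"
  using cinner_scaleC_left[of a y x] by (metis cinner_commute complex_cnj_mult)

lemma cinner_minus_left: "cinner (- x) (y::'a::chilbert) = - cinner x y"
  using cinner_add_left[of x "- x" y] by (simp add: add_eq_0_iff)

lemma cinner_minus_right: "cinner (x::'a::chilbert) (- y) = - cinner x y"
  using cinner_add_right[of x y "- y"] by (simp add: add_eq_0_iff)

lemma cinner_diff_left: "cinner (x - y) (z::'a::chilbert) = cinner x z - cinner y z"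
  using cinner_add_left[of x "- y" z] by (simp add: cinner_minus_left)

lemma cinner_diff_right: "cinner (z::'a::chilbert) (x - y) = cinner z x - cinner z y"
  using cinner_add_right[of z x "- y"] by (simp add: cinner_minus_right)

lemma cinner_sum_left: "cinner (sum f F) (y::'a::chilbert) = (\<Sum>i\<in>F. cinner (f i) y)"
  by (induction F rule: infinite_finite_induct) (auto simp: cinner_add_left)

lemma cinner_sum_right: "cinner (y::'a::chilbert) (sum f F) = (\<Sum>i\<in>F. cinner y (f i))"
  by (induction F rule: infinite_finite_induct) (auto simp: cinner_add_right)

lemmas cinner_algebra = cinner_add_left cinner_add_right cinner_diff_left cinner_diff_right
  cinner_minus_left cinner_minus_right cinner_scaleC_left cinner_scaleC_right
  cinner_sum_left cinner_sum_right

lemma Re_cinner_self: "Re (cinner x x) = (norm (x::'a::chilbert))\<^sup>2"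
  by (simp add: cinner_norm)

lemma cmod_cinner_commute: "cmod (cinner x y) = cmod (cinner y (x::'a::chilbert))"
  by (metis cinner_commute complex_mod_cnj)

lemma Re_cinner_commute: "Re (cinner x y) = Re (cinner y (x::'a::chilbert))"
  by (metis cinner_commute cnj.simps(1))

lemma norm_add_sq: "(norm (x + y))\<^sup>2 = (norm x)\<^sup>2 + (norm y)\<^sup>2 + 2 * Re (cinner x (y::'a::chilbert))"
  unfolding Re_cinner_self[symmetric] by (simp add: cinner_algebra Re_cinner_commute[of y x])

lemma norm_diff_sq: "(norm (x - y))\<^sup>2 = (norm x)\<^sup>2 + (norm y)\<^sup>2 - 2 * Re (cinner x (y::'a::chilbert))"
  unfolding Re_cinner_self[symmetric] by (simp add: cinner_algebra Re_cinner_commute[of y x])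

lemma norm_scaleC: "norm (scaleC a x) = cmod a * norm (x::'a::chilbert)"
proof -
  have "cinner (scaleC a x) (scaleC a x) = (a * cnj a) * cinner x x"
    by (simp add: cinner_scaleC_left cinner_scaleC_right)
  also have "\<dots> = complex_of_real ((cmod a * norm x)\<^sup>2)"
    by (simp only: complex_norm_square[symmetric] cinner_norm of_real_mult[symmetric] power_mult_distrib)
  finally have "(norm (scaleC a x))\<^sup>2 = (cmod a * norm x)\<^sup>2"
    by (simp only: cinner_norm of_real_eq_iff)
  then show ?thesis
    by simp
qed

lemma cinner_ext: "(\<And>y. cinner (x::'a::chilbert) y = cinner x' y) \<Longrightarrow> x = x'"
proof -
  assume "\<And>y. cinner x y = cinner x' y"
  then have "cinner (x - x') (x - x') = 0" by (simp add: cinner_diff_left)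
  then show ?thesis by (simp add: cinner_norm)
qed

lemma orthonormal_norm:
  assumes "orthonormal E" "e \<in> E"
  shows "norm (e::'a::chilbert) = 1"
proof -
  have "(norm e)\<^sup>2 = 1"
    using assms Re_cinner_self[of e] by (simp add: orthonormal_def)
  then show ?thesis using norm_ge_zero[of e] by (simp add: power2_eq_1_iff)
qed

lemma orthonormal_cinner:
  "orthonormal E \<Longrightarrow> e \<in> E \<Longrightarrow> e' \<in> E \<Longrightarrow> cinner e (e'::'a::chilbert) = (if e = e' then 1 else 0)"
  unfolding orthonormal_def by auto

lemma orthonormal_subset: "orthonormal E \<Longrightarrow> F \<subseteq> E \<Longrightarrow> orthonormal F"
  unfolding orthonormal_def by (meson subsetD)

section \<open>Pythagoras, Bessel and Cauchy-Schwarz\<close>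

lemma norm_sum_orthogonal:
  assumes "finite F" "\<And>i j. i \<in> F \<Longrightarrow> j \<in> F \<Longrightarrow> i \<noteq> j \<Longrightarrow> cinner (a i) (a j :: 'a::chilbert) = 0"
  shows "(norm (sum a F))\<^sup>2 = (\<Sum>i\<in>F. (norm (a i))\<^sup>2)"
  using assms
proof (induction F rule: finite_induct)
  case (insert i F)
  have "cinner (a i) (sum a F) = 0"
    unfolding cinner_sum_right using insert.hyps insert.prems by (intro sum.neutral) auto
  then show ?case using insert by (simp add: norm_add_sq)
qed simp

text \<open>Expand the square of \<open>norm (x - s)\<close>, where \<open>s\<close> sums the terms
  \<open>scaleC (cinner x (a i)) (a i)\<close>. Norms at most 1, rather than equal to 1, admit
  singular vectors that vanish because \<open>S e = 0\<close>.\<close>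

lemma bessel_family:
  fixes a :: "'i \<Rightarrow> 'a::chilbert"
  assumes "finite F" and orth: "\<And>i j. i \<in> F \<Longrightarrow> j \<in> F \<Longrightarrow> i \<noteq> j \<Longrightarrow> cinner (a i) (a j) = 0"
    and le1: "\<And>i. i \<in> F \<Longrightarrow> norm (a i) \<le> 1"
  shows "(\<Sum>i\<in>F. (cmod (cinner x (a i)))\<^sup>2) \<le> (norm x)\<^sup>2" (is "?t \<le> _")
proof -
  define s where "s = (\<Sum>i\<in>F. scaleC (cinner x (a i)) (a i))"
  have "(norm s)\<^sup>2 = (\<Sum>i\<in>F. (cmod (cinner x (a i)) * norm (a i))\<^sup>2)"
    unfolding s_def using assms
    by (subst norm_sum_orthogonal) (auto simp: cinner_algebra norm_scaleC)
  also have "\<dots> \<le> ?t"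
    using le1 by (intro sum_mono power_mono) (auto intro: mult_left_le)
  finally have s: "(norm s)\<^sup>2 \<le> ?t" .
  have "cinner x s = complex_of_real ?t"
    unfolding s_def by (simp add: cinner_algebra complex_norm_square mult.commute del: of_real_power)
  then have "(norm (x - s))\<^sup>2 = (norm x)\<^sup>2 + (norm s)\<^sup>2 - 2 * ?t"
    unfolding norm_diff_sq by simp
  then show ?thesis using s zero_le_power2[of "norm (x - s)"] by linarith
qed

lemma bessel_finite:
  assumes "finite F" "orthonormal F"
  shows "(\<Sum>e\<in>F. (cmod (cinner x e))\<^sup>2) \<le> (norm (x::'a::chilbert))\<^sup>2"
  using assms by (intro bessel_family) (auto simp: orthonormal_cinner orthonormal_norm)

text \<open>Bessel's inequality for the single unit vector \<open>u\<close> in the direction of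
  \<open>y\<close>.\<close>

lemma cauchy_schwarz: "cmod (cinner x y) \<le> norm x * norm (y::'a::chilbert)"
proof (cases "y = 0")
  case False
  define u where "u = scaleC (complex_of_real (1 / norm y)) y"
  have "orthonormal {u}"
    using False by (simp add: orthonormal_def u_def cinner_norm norm_scaleC norm_divide)
  then have "(cmod (cinner x u))\<^sup>2 \<le> (norm x)\<^sup>2"
    using bessel_finite[of "{u}" x] by simp
  then have "cmod (cinner x u) \<le> norm x"
    by (rule power2_le_imp_le) simp
  then show ?thesis
    using False by (simp add: u_def cinner_scaleC_right norm_mult norm_divide field_simps)
qed simp

lemma bounded_linear_cinner_left: "bounded_linear (\<lambda>x::'a::chilbert. cinner x y)"
proof (rule bounded_linear_intro[where K="norm y"])
  show "cinner (r *\<^sub>R x) y = r *\<^sub>R cinner x y" for r x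
    by (simp add: scaleC_scaleR[symmetric] cinner_scaleC_left scaleR_conv_of_real)
qed (auto simp: cinner_add_left cauchy_schwarz)

lemma bounded_op_bounded_linear: "bounded_op T \<Longrightarrow> bounded_linear T"
  unfolding bounded_op_def clinear_op_def
proof (elim conjE exE)
  fix K assume *: "\<forall>x y. T (x + y) = T x + T y" "\<forall>c x. T (scaleC c x) = scaleC c (T x)"
    "\<forall>x. norm (T x) \<le> K * norm x"
  show "bounded_linear T"
    by (rule bounded_linear_intro[where K=K])
       (use * in \<open>auto simp: scaleC_scaleR[symmetric] mult.commute\<close>)
qed

text \<open>The Cauchy criterion holds because the squared norm of a block of an orthogonal series is
  the corresponding block of the series of squared norms.\<close>
lemma orthogonal_summable_on:
  fixes a :: "'i \<Rightarrow> 'a::chilbert"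
  assumes orth: "\<And>i j. i \<in> E \<Longrightarrow> j \<in> E \<Longrightarrow> i \<noteq> j \<Longrightarrow> cinner (a i) (a j) = 0"
    and bd: "\<And>F. finite F \<Longrightarrow> F \<subseteq> E \<Longrightarrow> (\<Sum>i\<in>F. (norm (a i))\<^sup>2) \<le> M"
  shows "a summable_on E"
proof -
  have "(\<lambda>i. (norm (a i))\<^sup>2) summable_on E"
    by (rule nonneg_bdd_above_summable_on) (auto intro!: bdd_aboveI[where M=M] bd)
  then obtain L where L: "((\<lambda>i. (norm (a i))\<^sup>2) has_sum L) E"
    unfolding summable_on_def by blast
  have ev: "\<exists>P. eventually P (finite_subsets_at_top E) \<and>
          (\<forall>F F'. P F \<and> P F' \<longrightarrow> dist (sum a F) (sum a F') < \<epsilon>)" if eps: "\<epsilon> > 0" for \<epsilon>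
  proof -
    obtain F0 where F0: "finite F0" "F0 \<subseteq> E" "dist (\<Sum>i\<in>F0. (norm (a i))\<^sup>2) L \<le> (\<epsilon>/3)\<^sup>2"
      using has_sum_finite_approximation[OF L, of "(\<epsilon>/3)\<^sup>2"] eps by auto
    have close: "dist (sum a F) (sum a F0) \<le> \<epsilon>/3" if F: "finite F" "F0 \<subseteq> F" "F \<subseteq> E" for F
    proof -
      have "(norm (sum a (F - F0)))\<^sup>2 = (\<Sum>i\<in>F-F0. (norm (a i))\<^sup>2)"
        using F by (intro norm_sum_orthogonal orth) auto
      also have "\<dots> = (\<Sum>i\<in>F. (norm (a i))\<^sup>2) - (\<Sum>i\<in>F0. (norm (a i))\<^sup>2)"
        using F F0 by (simp add: sum_diff)
      also have "\<dots> \<le> L - (\<Sum>i\<in>F0. (norm (a i))\<^sup>2)"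
        using finite_sum_le_has_sum[OF L F(1) F(3)] by simp
      also have "\<dots> \<le> (\<epsilon>/3)\<^sup>2"
        using F0(3) by (simp add: dist_real_def)
      finally have "norm (sum a (F - F0)) \<le> \<epsilon>/3"
        by (rule power2_le_imp_le) (use eps in simp)
      then show ?thesis
        using F F0 by (simp add: dist_norm sum_diff)
    qed
    show ?thesis
    proof (intro exI conjI allI impI)
      show "eventually (\<lambda>F. finite F \<and> F0 \<subseteq> F \<and> F \<subseteq> E) (finite_subsets_at_top E)"
        unfolding eventually_finite_subsets_at_top using F0 by blast
    next
      fix F F' assume *: "(finite F \<and> F0 \<subseteq> F \<and> F \<subseteq> E) \<and> (finite F' \<and> F0 \<subseteq> F' \<and> F' \<subseteq> E)"
      have "dist (sum a F) (sum a F') \<le> \<epsilon>/3 + \<epsilon>/3"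
        using * close[of F] close[of F'] dist_triangle2[of "sum a F" "sum a F'" "sum a F0"] by simp
      then show "dist (sum a F) (sum a F') < \<epsilon>" using \<open>\<epsilon> > 0\<close> by simp
    qed
  qed
  \<comment> \<open>The index set may be uncountable, so completeness is applied to the filter of
    finite partial sums instead of a sequence.\<close>
  have "cauchy_filter (filtermap (sum a) (finite_subsets_at_top E))"
    unfolding cauchy_filter_metric_filtermap using ev by blast
  moreover have "complete (UNIV::'a set)"
    by (meson Cauchy_convergent UNIV_I complete_def convergent_def)
  ultimately obtain l where "(sum a \<longlongrightarrow> l) (finite_subsets_at_top E)"
    using complete_uniform[where S="UNIV::'a set"] by (force simp add: filterlim_def)
  then show ?thesis using summable_on_def has_sum_def by blast
qed

text \<open>The terms are orthogonal with squared norms |c e|^2, so the series converges; continuity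
  of the inner product reads off the coefficients. Later this builds adjoints and diagonal operators
  from prescribed coefficients.\<close>

lemma riesz_fischer:
  fixes E :: "'a::chilbert set"
  assumes E: "orthonormal E"
    and bd: "\<And>F. finite F \<Longrightarrow> F \<subseteq> E \<Longrightarrow> (\<Sum>e\<in>F. (cmod (c e))\<^sup>2) \<le> M"
  shows "\<exists>x. ((\<lambda>e. scaleC (c e) e) has_sum x) E \<and> (\<forall>e\<in>E. cinner x e = c e)"
proof -
  have "(\<lambda>e. scaleC (c e) e) summable_on E"
  proof (rule orthogonal_summable_on)
    show "(\<Sum>e\<in>F. (norm (scaleC (c e) e))\<^sup>2) \<le> M" if "finite F" "F \<subseteq> E" for F
    proof -
      have "(\<Sum>e\<in>F. (norm (scaleC (c e) e))\<^sup>2) = (\<Sum>e\<in>F. (cmod (c e))\<^sup>2)"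
        using that by (intro sum.cong) (auto simp: norm_scaleC orthonormal_norm[OF E] subset_iff)
      then show ?thesis using bd[OF that] by simp
    qed
  qed (use E in \<open>auto simp: cinner_algebra orthonormal_cinner\<close>)
  then obtain x where x: "((\<lambda>e. scaleC (c e) e) has_sum x) E"
    unfolding summable_on_def by blast
  have "cinner x e = c e" if "e \<in> E" for e
  proof -
    have "((\<lambda>e'. cinner (scaleC (c e') e') e) has_sum cinner x e) E"
      using has_sum_bounded_linear[OF bounded_linear_cinner_left x] by simp
    moreover have "((\<lambda>e'. cinner (scaleC (c e') e') e) has_sum c e) E"
      using that E by (intro has_sum_finite_neutralI[where B="{e}"])
        (auto simp: cinner_scaleC_left orthonormal_cinner)
    ultimately show ?thesis by (rule has_sum_unique)
  qed
  with x show ?thesis by blast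
qed

section \<open>Orthonormal bases: expansion and Parseval\<close>

lemma onb_orthonormal: "onb E \<Longrightarrow> orthonormal E"
  by (simp add: onb_def)

lemma onb_eqI:
  assumes "onb E" "\<And>e. e \<in> E \<Longrightarrow> cinner x e = cinner y e"
  shows "x = y"
proof -
  have "\<forall>e\<in>E. cinner (x - y) e = 0" using assms(2) by (simp add: cinner_diff_left)
  then have "x - y = 0" using assms(1) unfolding onb_def by blast
  then show ?thesis by simp
qed

text \<open>Riesz-Fischer yields a vector with the same coefficients as \<open>x\<close>; the two
  agree because no nonzero vector is orthogonal to \<open>E\<close>.\<close>

lemma onb_expansion:
  assumes "onb E"
  shows "((\<lambda>e. scaleC (cinner x e) e) has_sum x) E"
proof -
  note E = onb_orthonormal[OF assms]
  have "(\<Sum>e\<in>F. (cmod (cinner x e))\<^sup>2) \<le> (norm x)\<^sup>2" if "finite F" "F \<subseteq> E" for F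
    using that by (intro bessel_finite orthonormal_subset[OF E])
  then obtain y where y: "((\<lambda>e. scaleC (cinner x e) e) has_sum y) E"
      "\<And>e. e \<in> E \<Longrightarrow> cinner y e = cinner x e"
    using riesz_fischer[OF E, of "\<lambda>e. cinner x e" "(norm x)\<^sup>2"] by blast
  then have "y = x" by (intro onb_eqI[OF assms])
  with y(1) show ?thesis by simp
qed

lemma parseval:
  assumes "onb E"
  shows "((\<lambda>e. cinner x e * cinner e y) has_sum cinner x y) E"
  using has_sum_bounded_linear[OF bounded_linear_cinner_left onb_expansion[OF assms]]
  by (simp add: cinner_scaleC_left)

lemma parseval_norm:
  assumes "onb E"
  shows "((\<lambda>e. (cmod (cinner x e))\<^sup>2) has_sum (norm x)\<^sup>2) E"
proof -
  have "Re (cinner x e * cinner e x) = (cmod (cinner x e))\<^sup>2" for e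
    by (subst (2) cinner_commute) (simp add: cmod_def power2_eq_square[symmetric])
  then show ?thesis
    using has_sum_Re[OF parseval[OF assms, of x x]] by (simp add: Re_cinner_self)
qed

lemma bounded_op_expansion:
  assumes "onb E" "bounded_op T"
  shows "((\<lambda>e. scaleC (cinner x e) (T e)) has_sum T x) E"
proof -
  have "T (scaleC c y) = scaleC c (T y)" for c y
    using assms(2) by (simp add: bounded_op_def clinear_op_def)
  then show ?thesis
    using has_sum_bounded_linear[OF bounded_op_bounded_linear[OF assms(2)] onb_expansion[OF assms(1)]]
    by simp
qed

section \<open>Spectral theorem for compact self-adjoint operators\<close>

lemma cinner_scaleR_left: "cinner (r *\<^sub>R x) (y::'a::chilbert) = complex_of_real r * cinner x y"
  by (simp add: scaleC_scaleR[symmetric] cinner_scaleC_left)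

lemma cinner_scaleR_right: "cinner (x::'a::chilbert) (r *\<^sub>R y) = complex_of_real r * cinner x y"
  by (simp add: scaleC_scaleR[symmetric] cinner_scaleC_right)

lemma clinear_op_scaleR: "clinear_op T \<Longrightarrow> T (r *\<^sub>R x) = r *\<^sub>R T x"
  unfolding clinear_op_def by (metis scaleC_scaleR)

text \<open>This sequential form of compactness, unlike \<^const>\<open>compact_op\<close>, passes to adjoints and linear
  combinations by mere extraction of subsequences.\<close>
definition seq_compact_op :: "('a::chilbert \<Rightarrow> 'a) \<Rightarrow> bool" where
  "seq_compact_op T \<longleftrightarrow> bounded_op T \<and>
     (\<forall>x. (\<forall>n::nat. norm (x n) \<le> 1) \<longrightarrow> (\<exists>r l. strict_mono r \<and> (\<lambda>n. T (x (r n))) \<longlonglongrightarrow> l))"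

lemma seq_compact_opD:
  assumes "seq_compact_op T" "\<And>n::nat. norm (x n) \<le> 1"
  shows "\<exists>r l. strict_mono r \<and> (\<lambda>n. T (x (r n))) \<longlonglongrightarrow> l"
  using assms unfolding seq_compact_op_def by blast

text \<open>The compact closure of the image of the unit ball is bounded, which bounds
  \<open>T\<close> after rescaling; it is also sequentially compact, which gives the
  subsequences.\<close>

lemma compact_op_seq_compact_op:
  fixes T :: "'a::chilbert \<Rightarrow> 'a"
  assumes "compact_op T"
  shows "seq_compact_op T"
proof -
  have lin: "clinear_op T" and comp: "compact (closure (T ` cball 0 1))"
    using assms by (auto simp: compact_op_def)
  obtain K where K: "\<And>z. z \<in> closure (T ` cball 0 1) \<Longrightarrow> norm z \<le> K"
    using compact_imp_bounded[OF comp] unfolding bounded_iff by blast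
  have K1: "norm (T x) \<le> K" if "norm x \<le> 1" for x
    using that by (intro K subsetD[OF closure_subset]) auto
  have "norm (T x) \<le> K * norm x" for x
  proof (cases "x = 0")
    case True
    then show ?thesis using clinear_op_scaleR[OF lin, of 0 0] by simp
  next
    case False
    have "norm (T ((1 / norm x) *\<^sub>R x)) \<le> K"
      using False by (intro K1) simp
    then show ?thesis
      using False by (simp add: clinear_op_scaleR[OF lin] field_simps)
  qed
  then have "bounded_op T" using lin unfolding bounded_op_def by blast
  moreover have "\<exists>r l. strict_mono r \<and> (\<lambda>n. T (x (r n))) \<longlonglongrightarrow> l"
    if "\<forall>n::nat. norm (x n) \<le> 1" for x
  proof -
    have "\<forall>n. (T \<circ> x) n \<in> closure (T ` cball 0 1)"
      using that by (auto intro!: subsetD[OF closure_subset])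
    then obtain l r where "strict_mono r" "((T \<circ> x) \<circ> r) \<longlonglongrightarrow> l"
      using compact_imp_seq_compact[OF comp] unfolding seq_compact_def by blast
    then show ?thesis unfolding comp_def by blast
  qed
  ultimately show ?thesis unfolding seq_compact_op_def by blast
qed

lemma bounded_op_pos_bound:
  assumes "bounded_op T"
  obtains K where "K > 0" "\<And>x. norm (T x) \<le> K * norm x"
proof -
  obtain K where K: "\<And>x. norm (T x) \<le> K * norm x"
    using assms unfolding bounded_op_def by blast
  have "norm (T x) \<le> (\<bar>K\<bar> + 1) * norm x" for x
    using K[of x] by (rule order_trans) (intro mult_right_mono, auto)
  then show thesis by (intro that[of "\<bar>K\<bar> + 1"]) auto
qed

text \<open>With \<open>m\<close> the norm of \<open>A\<close> on \<open>M\<close>, a maximising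
  sequence of unit vectors is asymptotically fixed by A^2 / m^2. Compactness turns it into a unit
  vector \<open>u\<close> with A^2 u = m^2 u, and factoring A^2 - m^2 gives an eigenvector for
  \<open>m\<close> or \<open>- m\<close>. If \<open>m = 0\<close>, every unit vector of
  \<open>M\<close> will do.\<close>

lemma eigenvector_exists:
  fixes A :: "'a::chilbert \<Rightarrow> 'a"
  assumes comp: "seq_compact_op A" and sa: "self_adjoint A"
    and clM: "closed M" and addM: "\<And>x y. x \<in> M \<Longrightarrow> y \<in> M \<Longrightarrow> x + y \<in> M"
    and scM: "\<And>r x. x \<in> M \<Longrightarrow> r *\<^sub>R x \<in> M" and AM: "\<And>x. x \<in> M \<Longrightarrow> A x \<in> M"
    and z: "z \<in> M" "z \<noteq> 0"
  shows "\<exists>e\<in>M. norm e = 1 \<and> (\<exists>\<alpha>. A e = \<alpha> *\<^sub>R e)"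
proof -
  have bop: "bounded_op A" using comp by (simp add: seq_compact_op_def)
  note bl = bounded_op_bounded_linear[OF bop]
  interpret A: bounded_linear A by (rule bl)
  obtain K where K: "\<And>x. norm (A x) \<le> K * norm x" using bounded_op_pos_bound[OF bop] by blast
  define U where "U = {x\<in>M. norm x = 1}"
  have unit: "(1 / norm x) *\<^sub>R x \<in> U" if "x \<in> M" "x \<noteq> 0" for x
    using that by (simp add: U_def scM)
  define m where "m = (SUP x\<in>U. norm (A x))"
  have Une: "U \<noteq> {}" using unit[OF z] by blast
  have bdd: "bdd_above ((\<lambda>x. norm (A x)) ` U)"
  proof (rule bdd_aboveI2)
    show "norm (A x) \<le> K" if "x \<in> U" for x using K[of x] that by (simp add: U_def)
  qed
  have mU: "norm (A x) \<le> m" if "x \<in> U" for x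
    unfolding m_def by (rule cSUP_upper[OF that bdd])
  have mM: "norm (A x) \<le> m * norm x" if "x \<in> M" for x
  proof (cases "x = 0")
    case False
    show ?thesis using mU[OF unit[OF that False]] False by (simp add: A.scaleR field_simps)
  qed (simp add: A.zero)
  have m0: "m \<ge> 0" using mU Une by (meson all_not_in_conv norm_ge_zero order_trans)
  show ?thesis
  proof (cases "m = 0")
    case True
    obtain e where "e \<in> U" using Une by blast
    then have "A e = 0 *\<^sub>R e" using mU[of e] True by simp
    then show ?thesis using \<open>e \<in> U\<close> unfolding U_def by blast
  next
    case False
    then have mpos: "m > 0" using m0 by simp
    have "\<exists>x\<in>U. m - 1 / real (Suc n) < norm (A x)" for n
      using less_cSUP_iff[OF Une bdd, of "m - 1 / real (Suc n)"] by (simp add: m_def)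
    then obtain x where x: "\<And>n. x n \<in> U" "\<And>n. m - 1 / real (Suc n) < norm (A (x n))"
      by metis
    have "\<forall>n. norm (x n) \<le> 1" using x(1) by (simp add: U_def)
    then obtain r y where r: "strict_mono r" and y: "(\<lambda>n. A (x (r n))) \<longlonglongrightarrow> y"
      using comp unfolding seq_compact_op_def by blast
    have nAx: "(\<lambda>n. norm (A (x n))) \<longlonglongrightarrow> m"
    proof (rule tendsto_sandwich)
      show "(\<lambda>n. m - 1 / real (Suc n)) \<longlonglongrightarrow> m"
        using tendsto_diff[OF tendsto_const[of m] LIMSEQ_inverse_real_of_nat] by (simp add: inverse_eq_divide)
      show "(\<lambda>n. m) \<longlonglongrightarrow> m" by simp
      show "\<forall>\<^sub>F n in sequentially. m - 1 / real (Suc n) \<le> norm (A (x n))"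
        using x(2) by (intro always_eventually allI less_imp_le)
      show "\<forall>\<^sub>F n in sequentially. norm (A (x n)) \<le> m"
        using x(1) mU by (simp add: always_eventually)
    qed
    \<comment> \<open>Expand the square: by self-adjointness the mixed term is the square of
      \<open>norm (A (x n))\<close>, and \<open>norm (A (A (x n)))\<close> is at most
      \<open>m * norm (A (x n))\<close>. The resulting bound tends to 0 along the maximising
      sequence.\<close>
    have defect: "(norm (A (A (x n)) - m\<^sup>2 *\<^sub>R x n))\<^sup>2 \<le> m\<^sup>2 * (m\<^sup>2 - (norm (A (x n)))\<^sup>2)" for n
    proof -
      have xM: "x n \<in> M" "norm (x n) = 1" using x(1)[of n] by (auto simp: U_def)
      have "cinner (A (A (x n))) (x n) = cinner (A (x n)) (A (x n))"
        using sa by (simp add: self_adjoint_def)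
      then have "(norm (A (A (x n)) - m\<^sup>2 *\<^sub>R x n))\<^sup>2
          = (norm (A (A (x n))))\<^sup>2 + m^4 - 2 * m\<^sup>2 * (norm (A (x n)))\<^sup>2"
        unfolding norm_diff_sq cinner_scaleR_right by (simp add: xM Re_cinner_self flip: power_mult)
      moreover have "(norm (A (A (x n))))\<^sup>2 \<le> (m * norm (A (x n)))\<^sup>2"
        using mM[OF AM[OF xM(1)]] by (intro power_mono) auto
      ultimately show ?thesis
        by (simp add: algebra_simps power4_eq_xxxx power2_eq_square)
    qed
    have "(\<lambda>n. m\<^sup>2 * (m\<^sup>2 - (norm (A (x n)))\<^sup>2)) \<longlonglongrightarrow> m\<^sup>2 * (m\<^sup>2 - m\<^sup>2)"
      by (intro tendsto_intros nAx)
    then have lim0: "(\<lambda>n. m\<^sup>2 * (m\<^sup>2 - (norm (A (x n)))\<^sup>2)) \<longlonglongrightarrow> 0" by simp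
    have "(\<lambda>n. (norm (A (A (x n)) - m\<^sup>2 *\<^sub>R x n))\<^sup>2) \<longlonglongrightarrow> 0"
      by (rule tendsto_sandwich[OF _ _ tendsto_const[of 0] lim0]) (simp_all add: defect)
    then have "(\<lambda>n. sqrt ((norm (A (A (x n)) - m\<^sup>2 *\<^sub>R x n))\<^sup>2)) \<longlonglongrightarrow> sqrt 0"
      by (rule tendsto_real_sqrt)
    then have d0: "(\<lambda>n. A (A (x n)) - m\<^sup>2 *\<^sub>R x n) \<longlonglongrightarrow> 0"
      by (simp add: tendsto_norm_zero_iff)
    have d1: "(\<lambda>n. A (A (x (r n))) - m\<^sup>2 *\<^sub>R x (r n)) \<longlonglongrightarrow> 0"
      using LIMSEQ_subseq_LIMSEQ[OF d0 r] by (simp add: comp_def)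
    \<comment> \<open>Solving the vanishing defect for \<open>x (r n)\<close> turns convergence of
      \<open>A (x (r n))\<close> into convergence of \<open>x (r n)\<close> itself.\<close>
    have "(\<lambda>n. (1 / m\<^sup>2) *\<^sub>R (A (A (x (r n))) - (A (A (x (r n))) - m\<^sup>2 *\<^sub>R x (r n))))
        \<longlonglongrightarrow> (1 / m\<^sup>2) *\<^sub>R (A y - 0)"
      by (intro tendsto_intros A.tendsto[OF y] d1)
    moreover define u where "u = (1 / m\<^sup>2) *\<^sub>R A y"
    ultimately have xu: "(\<lambda>n. x (r n)) \<longlonglongrightarrow> u" using mpos by simp
    have uM: "u \<in> M"
      by (rule closed_sequentially[OF clM _ xu]) (use x(1) in \<open>auto simp: U_def\<close>)
    have "(\<lambda>n. norm (x (r n))) \<longlonglongrightarrow> norm u" by (intro tendsto_intros xu)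
    then have "(\<lambda>n. 1) \<longlonglongrightarrow> norm u" using x(1) by (simp add: U_def)
    then have u1: "norm u = 1" by (simp add: LIMSEQ_const_iff)
    have "A u = y" using LIMSEQ_unique[OF A.tendsto[OF xu] y] .
    then have AAu: "A (A u) = m\<^sup>2 *\<^sub>R u" using mpos by (simp add: u_def)
    \<comment> \<open>Since (A - m)(A + m) u = 0, either \<open>w\<close> is an eigenvector for
      \<open>m\<close>, or it is zero and \<open>u\<close> is one for \<open>- m\<close>.\<close>
    define w where "w = A u + m *\<^sub>R u"
    show ?thesis
    proof (cases "w = 0")
      case True
      then have "A u = (- m) *\<^sub>R u" by (simp add: w_def add_eq_0_iff)
      then show ?thesis using uM u1 by blast
    next
      case False
      have wM: "w \<in> M" unfolding w_def by (intro addM AM scM uM)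
      have "A w = m *\<^sub>R w"
        by (simp add: w_def A.add A.scaleR AAu scaleR_add_right power2_eq_square)
      then have "A ((1 / norm w) *\<^sub>R w) = m *\<^sub>R ((1 / norm w) *\<^sub>R w)" by (simp add: A.scaleR)
      then show ?thesis using unit[OF wM False] unfolding U_def by blast
    qed
  qed
qed

text \<open>Zorn's lemma gives a maximal orthonormal set of eigenvectors. Its orthogonal complement
  \<open>M\<close> is closed and invariant under \<open>A\<close>, so a nonzero element of
  \<open>M\<close> would lead to a further eigenvector and contradict maximality.\<close>

theorem compact_self_adjoint_eigenbasis:
  fixes A :: "'a::chilbert \<Rightarrow> 'a"
  assumes comp: "seq_compact_op A" and sa: "self_adjoint A"
  obtains E \<alpha> where "onb E" "\<And>e. e \<in> E \<Longrightarrow> A e = \<alpha> e *\<^sub>R e"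
proof -
  define \<A> where "\<A> = {E. orthonormal E \<and> (\<forall>e\<in>E. \<exists>\<alpha>. A e = \<alpha> *\<^sub>R e)}"
  have "\<exists>E\<in>\<A>. \<forall>X\<in>\<A>. E \<subseteq> X \<longrightarrow> X = E"
  proof (rule subset_Zorn')
    fix C assume C: "subset.chain \<A> C"
    have sub: "E \<in> \<A>" if "E \<in> C" for E
      using C that unfolding subset.chain_def by auto
    have lin: "X \<subseteq> Y \<or> Y \<subseteq> X" if "X \<in> C" "Y \<in> C" for X Y
      using C that unfolding subset.chain_def by auto
    have "cinner e e' = (if e = e' then 1 else 0)" if ee: "e \<in> \<Union>C" "e' \<in> \<Union>C" for e e'
    proof -
      obtain X Y where XY: "X \<in> C" "e \<in> X" "Y \<in> C" "e' \<in> Y" using ee by blast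
      then obtain Z where "Z \<in> C" "e \<in> Z" "e' \<in> Z" using lin[of X Y] by (metis subsetD)
      then show ?thesis using sub[of Z] orthonormal_cinner[of Z e e'] by (simp add: \<A>_def)
    qed
    then have "orthonormal (\<Union>C)" unfolding orthonormal_def by simp
    moreover have "\<exists>\<alpha>. A e = \<alpha> *\<^sub>R e" if e: "e \<in> \<Union>C" for e
    proof -
      obtain X where "X \<in> C" "e \<in> X" using e by blast
      then show ?thesis using sub[of X] by (simp add: \<A>_def)
    qed
    ultimately show "\<Union>C \<in> \<A>" unfolding \<A>_def by simp
  qed
  then obtain E where E: "orthonormal E" "\<forall>e\<in>E. \<exists>\<alpha>. A e = \<alpha> *\<^sub>R e"
    and max: "\<And>X. X \<in> \<A> \<Longrightarrow> E \<subseteq> X \<Longrightarrow> X = E"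
    unfolding \<A>_def by auto
  define M where "M = {x. \<forall>e\<in>E. cinner x e = 0}"
  have "closed M"
  proof -
    have "M = (\<Inter>e\<in>E. (\<lambda>x. cinner x e) -` {0})" unfolding M_def by auto
    moreover have "closed ((\<lambda>x. cinner x e) -` {0})" for e :: 'a
      by (intro closed_vimage closed_singleton linear_continuous_on bounded_linear_cinner_left)
    ultimately show ?thesis by (simp add: closed_INT)
  qed
  moreover have "x + y \<in> M" if "x \<in> M" "y \<in> M" for x y
    using that by (simp add: M_def cinner_add_left)
  moreover have "r *\<^sub>R x \<in> M" if "x \<in> M" for r x
    using that by (simp add: M_def cinner_scaleR_left)
  moreover have "A x \<in> M" if x: "x \<in> M" for x
    unfolding M_def
  proof (intro CollectI ballI)
    fix e assume e: "e \<in> E"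
    then obtain \<alpha> where "A e = \<alpha> *\<^sub>R e" using E(2) by blast
    then show "cinner (A x) e = 0"
      using sa x e by (simp add: self_adjoint_def cinner_scaleR_right M_def)
  qed
  ultimately have ev: "\<exists>e\<in>M. norm e = 1 \<and> (\<exists>\<alpha>. A e = \<alpha> *\<^sub>R e)" if "z \<in> M" "z \<noteq> 0" for z
    using eigenvector_exists[OF comp sa, of M] that by simp
  have "z = 0" if z: "\<forall>e\<in>E. cinner z e = 0" for z
  proof (rule ccontr)
    assume "z \<noteq> 0"
    then obtain e \<alpha> where e: "e \<in> M" "norm e = 1" "A e = \<alpha> *\<^sub>R e"
      using ev[of z] z by (auto simp: M_def)
    have "cinner e e' = 0" "cinner e' e = 0" if "e' \<in> E" for e'
      using e(1) that cinner_commute[of e' e] by (auto simp: M_def)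
    then have "orthonormal (insert e E)"
      using E(1) e(2) by (auto simp: orthonormal_def cinner_norm)
    then have "insert e E \<in> \<A>" using E(2) e(3) by (auto simp: \<A>_def)
    then have "e \<in> E" using max[of "insert e E"] by auto
    then show False using e(1,2) by (auto simp: M_def cinner_norm)
  qed
  then have "onb E" using E(1) by (simp add: onb_def)
  moreover obtain \<alpha> where "\<And>e. e \<in> E \<Longrightarrow> A e = \<alpha> e *\<^sub>R e" using E(2) by metis
  ultimately show thesis by (rule that)
qed

text \<open>An eigenbasis of the zero operator.\<close>

lemma onb_exists: "\<exists>E::'a::chilbert set. onb E"
proof -
  have "seq_compact_op (\<lambda>x::'a. 0)"
    unfolding seq_compact_op_def bounded_op_def clinear_op_def
    by (auto simp: scaleC_zero_right intro!: exI[of _ 0] exI[of _ id] strict_mono_id)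
  moreover have "self_adjoint (\<lambda>x::'a. 0)" by (simp add: self_adjoint_def)
  ultimately show ?thesis by (rule compact_self_adjoint_eigenbasis) blast
qed

section \<open>Adjoints, the modulus and its eigenvalues\<close>

text \<open>The coefficients of the image of \<open>y\<close> must be \<open>cinner y (T e)\<close>.
  They are square summable: for a finite partial sum \<open>z\<close>, the square of
  \<open>norm z\<close> equals |<y, T z>|, which is at most
  \<open>norm y * (K * norm z)\<close>.\<close>

lemma adjoint_exists:
  fixes T :: "'a::chilbert \<Rightarrow> 'a"
  assumes "bounded_op T"
  shows "\<exists>T'. \<forall>x y. cinner (T x) y = cinner x (T' y)"
proof -
  obtain E :: "'a set" where E: "onb E" using onb_exists by blast
  note oE = onb_orthonormal[OF E]
  interpret T: bounded_linear T by (rule bounded_op_bounded_linear[OF assms])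
  have TC: "T (scaleC c x) = scaleC c (T x)" for c x
    using assms by (simp add: bounded_op_def clinear_op_def)
  obtain K where K: "K > 0" "\<And>x. norm (T x) \<le> K * norm x" using bounded_op_pos_bound[OF assms] by blast
  have "\<exists>z. \<forall>e\<in>E. cinner z e = cinner y (T e)" for y
  proof -
    have "(\<Sum>e\<in>F. (cmod (cinner y (T e)))\<^sup>2) \<le> (K * norm y)\<^sup>2" (is "?s \<le> _") if F: "finite F" "F \<subseteq> E" for F
    proof -
      define z where "z = (\<Sum>e\<in>F. scaleC (cinner y (T e)) e)"
      have oF: "orthonormal F" using orthonormal_subset[OF oE F(2)] .
      have z: "(norm z)\<^sup>2 = ?s"
        unfolding z_def using F(1) oF
        by (subst norm_sum_orthogonal)
           (auto simp: cinner_algebra orthonormal_cinner norm_scaleC orthonormal_norm)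
      have "cinner y (T z) = complex_of_real ?s"
        unfolding z_def by (simp add: T.sum TC cinner_algebra complex_norm_square mult.commute del: of_real_power)
      then have "(norm z)\<^sup>2 = cmod (cinner y (T z))"
        unfolding z by (simp add: sum_nonneg del: of_real_sum)
      also have "\<dots> \<le> norm y * (K * norm z)"
        using cauchy_schwarz[of y "T z"] mult_left_mono[OF K(2)[of z] norm_ge_zero[of y]] by simp
      finally have "norm z * norm z \<le> (K * norm y) * norm z" by (simp add: power2_eq_square mult_ac)
      then have "norm z \<le> K * norm y"
        by (cases "norm z = 0") (use K(1) in auto)
      then show ?thesis unfolding z[symmetric] by (intro power_mono) auto
    qed
    then show ?thesis using riesz_fischer[OF oE, of "\<lambda>e. cinner y (T e)"] by blast
  qed
  then obtain T' where T': "\<And>y e. e \<in> E \<Longrightarrow> cinner (T' y) e = cinner y (T e)" by metis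
  have "cinner (T x) y = cinner x (T' y)" for x y
  proof -
    have "((\<lambda>e. cinner x e * cinner (T e) y) has_sum cinner (T x) y) E"
      using has_sum_bounded_linear[OF bounded_linear_cinner_left bounded_op_expansion[OF E assms]]
      by (simp add: cinner_scaleC_left)
    moreover have "cinner (T e) y = cinner e (T' y)" if "e \<in> E" for e
      using T'[OF that, of y] by (metis cinner_commute)
    ultimately have "((\<lambda>e. cinner x e * cinner e (T' y)) has_sum cinner (T x) y) E"
      by (simp cong: has_sum_cong)
    then show ?thesis using parseval[OF E] by (rule has_sum_unique)
  qed
  then show ?thesis by blast
qed

text \<open>Uniqueness of the adjoint, which lets the definite description in \<open>adjoint\<close>
  be evaluated.\<close>

lemma adjoint_eqI:
  assumes "\<And>x y. cinner (T x) y = cinner x (T' y)"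
  shows "adjoint T = T'"
  unfolding adjoint_def
proof (rule the_equality)
  fix R assume R: "\<forall>x y. cinner (T x) y = cinner x (R y)"
  have "R y = T' y" for y
  proof (rule cinner_ext)
    fix z
    have "cinner z (R y) = cinner z (T' y)" using R assms by metis
    then show "cinner (R y) z = cinner (T' y) z" by (metis cinner_commute)
  qed
  then show "R = T'" by blast
qed (use assms in blast)

lemma cinner_adjoint: "bounded_op T \<Longrightarrow> cinner (T x) y = cinner x (adjoint T y)"
  using adjoint_exists[of T] adjoint_eqI[of T] by metis

lemma cinner_adjoint': "bounded_op T \<Longrightarrow> cinner (adjoint T x) y = cinner x (T y)"
  using cinner_adjoint[of T y x] by (metis cinner_commute)

lemma bounded_op_adjoint:
  assumes "bounded_op T"
  shows "bounded_op (adjoint T)"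
proof -
  note adj = cinner_adjoint'[OF assms]
  obtain K where K: "K > 0" "\<And>x. norm (T x) \<le> K * norm x" using bounded_op_pos_bound[OF assms] by blast
  have "norm (adjoint T y) \<le> K * norm y" for y
  proof -
    let ?z = "adjoint T y"
    have "(norm ?z)\<^sup>2 = cmod (cinner y (T ?z))"
      using adj[of y ?z] by (metis Re_cinner_self cinner_norm norm_of_real abs_of_nonneg zero_le_power2)
    also have "\<dots> \<le> norm y * (K * norm ?z)"
      using cauchy_schwarz[of y "T ?z"] mult_left_mono[OF K(2)[of ?z] norm_ge_zero[of y]] by simp
    finally have "norm ?z * norm ?z \<le> (K * norm y) * norm ?z" by (simp add: power2_eq_square mult_ac)
    then show ?thesis by (cases "norm ?z = 0") (use K(1) in auto)
  qed
  moreover have "adjoint T (x + y) = adjoint T x + adjoint T y" for x y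
    by (rule cinner_ext) (simp add: adj cinner_add_left)
  moreover have "adjoint T (scaleC c x) = scaleC c (adjoint T x)" for c x
    by (rule cinner_ext) (simp add: adj cinner_scaleC_left)
  ultimately show ?thesis unfolding bounded_op_def clinear_op_def by blast
qed

section \<open>Composition, linear combinations and adjoints of compact operators\<close>

lemma bounded_op_comp:
  assumes "bounded_op S" "bounded_op T"
  shows "bounded_op (\<lambda>x. S (T x))"
proof -
  obtain K where K: "K > 0" "\<And>x. norm (S x) \<le> K * norm x" using bounded_op_pos_bound[OF assms(1)] by blast
  obtain L where L: "L > 0" "\<And>x. norm (T x) \<le> L * norm x" using bounded_op_pos_bound[OF assms(2)] by blast
  have "norm (S (T x)) \<le> (K * L) * norm x" for x
    using order_trans[OF K(2)[of "T x"] mult_left_mono[OF L(2)[of x]]] K(1) by (simp add: mult.assoc)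
  then show ?thesis using assms unfolding bounded_op_def clinear_op_def by auto
qed

lemma seq_compact_op_comp:
  assumes "bounded_op S" "seq_compact_op T"
  shows "seq_compact_op (\<lambda>x. S (T x))"
proof -
  interpret S: bounded_linear S by (rule bounded_op_bounded_linear[OF assms(1)])
  have "\<exists>r l. strict_mono r \<and> (\<lambda>n. S (T (x (r n)))) \<longlonglongrightarrow> l"
    if x: "\<forall>n::nat. norm (x n) \<le> 1" for x
  proof -
    obtain r l where "strict_mono r" "(\<lambda>n. T (x (r n))) \<longlonglongrightarrow> l"
      using seq_compact_opD[OF assms(2), of x] x by blast
    then show ?thesis using S.tendsto by blast
  qed
  then show ?thesis
    using bounded_op_comp[OF assms(1)] assms(2) unfolding seq_compact_op_def by blast
qed

lemma bounded_op_lincomb: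
  assumes "bounded_op S" "bounded_op T"
  shows "bounded_op (\<lambda>x. scaleC a (S x) + scaleC b (T x))"
proof -
  obtain K where K: "K > 0" "\<And>x. norm (S x) \<le> K * norm x" using bounded_op_pos_bound[OF assms(1)] by blast
  obtain L where L: "L > 0" "\<And>x. norm (T x) \<le> L * norm x" using bounded_op_pos_bound[OF assms(2)] by blast
  have "norm (scaleC a (S x) + scaleC b (T x)) \<le> (cmod a * K + cmod b * L) * norm x" for x
  proof -
    have "norm (scaleC a (S x) + scaleC b (T x)) \<le> cmod a * norm (S x) + cmod b * norm (T x)"
      using norm_triangle_ineq[of "scaleC a (S x)" "scaleC b (T x)"] by (simp add: norm_scaleC)
    also have "\<dots> \<le> cmod a * (K * norm x) + cmod b * (L * norm x)"
      by (intro add_mono mult_left_mono K L) auto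
    finally show ?thesis by (simp add: algebra_simps)
  qed
  moreover have "clinear_op (\<lambda>x. scaleC a (S x) + scaleC b (T x))"
    using assms unfolding bounded_op_def clinear_op_def
    by (simp add: scaleC_add_right scaleC_scaleC mult.commute)
  ultimately show ?thesis unfolding bounded_op_def by blast
qed

lemma seq_compact_op_lincomb:
  assumes "seq_compact_op S" "seq_compact_op T"
  shows "seq_compact_op (\<lambda>x. scaleC a (S x) + scaleC b (T x))"
proof -
  have sc: "bounded_linear (scaleC c :: 'a \<Rightarrow> 'a)" for c
    by (rule bounded_linear_intro[where K="cmod c"])
       (auto simp: scaleC_add_right norm_scaleC scaleC_scaleC scaleC_scaleR[symmetric] mult.commute)
  have "\<exists>r l. strict_mono r \<and> (\<lambda>n. scaleC a (S (x (r n))) + scaleC b (T (x (r n)))) \<longlonglongrightarrow> l"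
    if x: "\<forall>n::nat. norm (x n) \<le> 1" for x
  proof -
    obtain r l where r: "strict_mono r" and l: "(\<lambda>n. S (x (r n))) \<longlonglongrightarrow> l"
      using seq_compact_opD[OF assms(1), of x] x by blast
    obtain r' l' where r': "strict_mono r'" and l': "(\<lambda>n. T (x (r (r' n)))) \<longlonglongrightarrow> l'"
      using seq_compact_opD[OF assms(2), of "\<lambda>n. x (r n)"] x by blast
    have "(\<lambda>n. S (x (r (r' n)))) \<longlonglongrightarrow> l"
      using LIMSEQ_subseq_LIMSEQ[OF l r'] by (simp add: comp_def)
    then have "(\<lambda>n. scaleC a (S (x (r (r' n)))) + scaleC b (T (x (r (r' n))))) \<longlonglongrightarrow> scaleC a l + scaleC b l'"
      by (intro tendsto_add bounded_linear.tendsto[OF sc] l')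
    then show ?thesis using strict_mono_o[OF r r'] unfolding comp_def by blast
  qed
  then show ?thesis
    using bounded_op_lincomb assms unfolding seq_compact_op_def by blast
qed

text \<open>Along a subsequence the images under the composite T T* converge. For d = y m - y n, of
  norm at most 2, the squared norm of T* d is <T T* d, d>, hence at most twice the norm of T T* d;
  so the images under T* are Cauchy.\<close>

lemma seq_compact_op_adjoint:
  fixes T :: "'a::chilbert \<Rightarrow> 'a"
  assumes "seq_compact_op T"
  shows "seq_compact_op (adjoint T)"
proof -
  have bT: "bounded_op T" using assms by (simp add: seq_compact_op_def)
  note bA = bounded_op_adjoint[OF bT]
  interpret T: bounded_linear T by (rule bounded_op_bounded_linear[OF bT])
  interpret A: bounded_linear "adjoint T" by (rule bounded_op_bounded_linear[OF bA])
  obtain K where K: "K > 0" "\<And>x. norm (adjoint T x) \<le> K * norm x" using bounded_op_pos_bound[OF bA] by blast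
  have "\<exists>r l. strict_mono r \<and> (\<lambda>n. adjoint T (y (r n))) \<longlonglongrightarrow> l"
    if y: "\<forall>n::nat. norm (y n) \<le> 1" for y
  proof -
    \<comment> \<open>Dividing by the operator bound \<open>K\<close> moves the vectors into the
      unit ball, where compactness of \<open>T\<close> applies.\<close>
    have "norm ((1 / K) *\<^sub>R adjoint T (y n)) \<le> 1" for n
      using order_trans[OF K(2)[of "y n"] mult_left_mono[of "norm (y n)" 1 K]] K(1) y by (simp add: field_simps)
    then obtain r l where r: "strict_mono r" and l: "(\<lambda>n. T ((1 / K) *\<^sub>R adjoint T (y (r n)))) \<longlonglongrightarrow> l"
      using seq_compact_opD[OF assms, of "\<lambda>n. (1 / K) *\<^sub>R adjoint T (y n)"] by blast
    have "(\<lambda>n. K *\<^sub>R T ((1 / K) *\<^sub>R adjoint T (y (r n)))) \<longlonglongrightarrow> K *\<^sub>R l"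
      by (intro tendsto_intros l)
    then have "(\<lambda>n. T (adjoint T (y (r n)))) \<longlonglongrightarrow> K *\<^sub>R l"
      using K(1) by (simp add: T.scaleR)
    then have C: "Cauchy (\<lambda>n. T (adjoint T (y (r n))))" by (rule LIMSEQ_imp_Cauchy)
    have est: "(norm (adjoint T (y m) - adjoint T (y n)))\<^sup>2
        \<le> 2 * norm (T (adjoint T (y m)) - T (adjoint T (y n)))" for m n
    proof -
      let ?d = "y m - y n"
      have "(norm (adjoint T ?d))\<^sup>2 = cmod (cinner (T (adjoint T ?d)) ?d)"
        by (simp add: cinner_adjoint[OF bT] cinner_norm norm_power)
      also have "\<dots> \<le> norm (T (adjoint T ?d)) * norm ?d" by (rule cauchy_schwarz)
      also have "\<dots> \<le> norm (T (adjoint T ?d)) * 2"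
      proof (rule mult_left_mono)
        show "norm ?d \<le> 2"
          using y[rule_format, of m] y[rule_format, of n] norm_triangle_ineq4[of "y m" "y n"] by linarith
      qed simp
      finally show ?thesis by (simp add: A.diff T.diff)
    qed
    have "Cauchy (\<lambda>n. adjoint T (y (r n)))"
    proof (rule metric_CauchyI)
      fix \<epsilon> :: real assume \<epsilon>: "\<epsilon> > 0"
      obtain M where M: "\<And>m n. m \<ge> M \<Longrightarrow> n \<ge> M \<Longrightarrow>
          dist (T (adjoint T (y (r m)))) (T (adjoint T (y (r n)))) < \<epsilon>\<^sup>2 / 2"
        using metric_CauchyD[OF C, of "\<epsilon>\<^sup>2 / 2"] \<epsilon> by auto
      have "dist (adjoint T (y (r m))) (adjoint T (y (r n))) < \<epsilon>" if "m \<ge> M" "n \<ge> M" for m n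
      proof (rule power_less_imp_less_base[of _ 2])
        show "(dist (adjoint T (y (r m))) (adjoint T (y (r n))))\<^sup>2 < \<epsilon>\<^sup>2"
          using est[of "r m" "r n"] M[OF that] by (simp add: dist_norm)
      qed (use \<epsilon> in simp)
      then show "\<exists>M. \<forall>m\<ge>M. \<forall>n\<ge>M. dist (adjoint T (y (r m))) (adjoint T (y (r n))) < \<epsilon>" by blast
    qed
    then show ?thesis using r Cauchy_convergent unfolding convergent_def by blast
  qed
  then show ?thesis using bA unfolding seq_compact_op_def by blast
qed

text \<open>On the eigenvector \<open>w = Q e - \<sigma> e\<close> for \<open>- \<sigma>\<close> positivity forces \<open>w = 0\<close> if \<open>\<sigma> > 0\<close>; if \<open>\<sigma> = 0\<close>
  the form of \<open>Q\<close> at \<open>Q e - t e\<close> would be negative for small \<open>t > 0\<close>.\<close>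
lemma positive_op_sqrt_eigenvector:
  assumes Q: "positive_op Q" and "\<sigma> \<ge> 0" and e: "Q (Q e) = \<sigma>\<^sup>2 *\<^sub>R e"
  shows "Q e = \<sigma> *\<^sub>R (e::'a::chilbert)"
proof -
  interpret Q: bounded_linear Q
    using Q by (intro bounded_op_bounded_linear) (simp add: positive_op_def)
  have pos: "Re (cinner (Q x) x) \<ge> 0" for x using Q by (simp add: positive_op_def)
  define w where "w = Q e - \<sigma> *\<^sub>R e"
  have Qw: "Q w = - (\<sigma> *\<^sub>R w)"
    by (simp add: w_def Q.diff Q.scaleR e scaleR_diff_right power2_eq_square)
  show ?thesis
  proof (cases "\<sigma> = 0")
    case False
    have "Re (cinner (Q w) w) = - (\<sigma> * (norm w)\<^sup>2)"
      unfolding Qw by (simp add: cinner_minus_left cinner_scaleR_left Re_cinner_self)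
    then have "\<sigma> * (norm w)\<^sup>2 \<le> 0" using pos[of w] by simp
    then have "w = 0" using False \<open>\<sigma> \<ge> 0\<close> by (simp add: mult_le_0_iff)
    then show ?thesis by (simp add: w_def)
  next
    case True
    then have w: "w = Q e" "Q w = 0" using Qw by (auto simp: w_def)
    have "(norm w)\<^sup>2 \<le> t * Re (cinner w e)" if t: "t > 0" for t
    proof -
      have "Q (w - t *\<^sub>R e) = - (t *\<^sub>R w)" using w by (simp add: Q.diff Q.scaleR)
      then have "Re (cinner (Q (w - t *\<^sub>R e)) (w - t *\<^sub>R e)) = t * (t * Re (cinner w e) - (norm w)\<^sup>2)"
        by (simp add: cinner_algebra cinner_scaleR_left cinner_scaleR_right Re_cinner_self algebra_simps)
      then show ?thesis using pos[of "w - t *\<^sub>R e"] t by (simp add: zero_le_mult_iff)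
    qed
    moreover have "((\<lambda>t. t * Re (cinner w e)) \<longlongrightarrow> 0 * Re (cinner w e)) (at_right 0)"
      by (intro tendsto_intros)
    ultimately have "(norm w)\<^sup>2 \<le> 0 * Re (cinner w e)"
      by (intro tendsto_lowerbound[where F="at_right (0::real)"]) (auto simp: eventually_at_right_less eventually_at_filter)
    then show ?thesis using w True by simp
  qed
qed

text \<open>Multiplying coefficients by bounded numbers keeps them square summable, so Riesz-Fischer
  defines the operator; Parseval gives its norm bound and positivity. For empty \<open>E\<close> the
  bound \<open>K\<close> may be negative, hence the absolute value in the estimates.\<close>

lemma diagonal_op_exists:
  fixes E :: "'a::chilbert set"
  assumes E: "onb E" and c: "\<And>e. e \<in> E \<Longrightarrow> 0 \<le> c e \<and> c e \<le> K"
  shows "\<exists>R. positive_op R \<and> (\<forall>x. \<forall>e\<in>E. cinner (R x) e = complex_of_real (c e) * cinner x e)"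
proof -
  note oE = onb_orthonormal[OF E]
  have bd: "(\<Sum>e\<in>F. (cmod (complex_of_real (c e) * cinner x e))\<^sup>2) \<le> (\<bar>K\<bar> * norm x)\<^sup>2"
    if F: "finite F" "F \<subseteq> E" for F x
  proof -
    have "(\<Sum>e\<in>F. (cmod (complex_of_real (c e) * cinner x e))\<^sup>2) \<le> (\<Sum>e\<in>F. K\<^sup>2 * (cmod (cinner x e))\<^sup>2)"
    proof (rule sum_mono)
      fix e assume "e \<in> F"
      then have "(c e)\<^sup>2 \<le> K\<^sup>2" using c F(2) by (intro power_mono) auto
      then show "(cmod (complex_of_real (c e) * cinner x e))\<^sup>2 \<le> K\<^sup>2 * (cmod (cinner x e))\<^sup>2"
        by (simp add: norm_mult power_mult_distrib mult_right_mono)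
    qed
    also have "\<dots> \<le> K\<^sup>2 * (norm x)\<^sup>2"
      unfolding sum_distrib_left[symmetric]
      by (intro mult_left_mono bessel_finite F orthonormal_subset[OF oE]) auto
    finally show ?thesis by (simp add: power_mult_distrib)
  qed
  have "\<exists>z. \<forall>e\<in>E. cinner z e = complex_of_real (c e) * cinner x e" for x
    using riesz_fischer[OF oE bd[of _ x]] by blast
  then obtain R where R: "\<And>x e. e \<in> E \<Longrightarrow> cinner (R x) e = complex_of_real (c e) * cinner x e" by metis
  have "norm (R x) \<le> \<bar>K\<bar> * norm x" for x
  proof (rule power2_le_imp_le)
    have "(\<Sum>e\<in>F. (cmod (cinner (R x) e))\<^sup>2) \<le> (\<bar>K\<bar> * norm x)\<^sup>2" if "finite F" "F \<subseteq> E" for F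
      using bd[OF that, of x] that R by (simp add: subset_iff)
    then show "(norm (R x))\<^sup>2 \<le> (\<bar>K\<bar> * norm x)\<^sup>2"
      by (intro has_sum_le_finite_sums[OF parseval_norm[OF E]])
  qed simp
  moreover have "R (x + y) = R x + R y" for x y
    by (rule onb_eqI[OF E]) (simp add: R cinner_add_left algebra_simps)
  moreover have "R (scaleC a x) = scaleC a (R x)" for a x
    by (rule onb_eqI[OF E]) (simp add: R cinner_scaleC_left)
  ultimately have "bounded_op R" unfolding bounded_op_def clinear_op_def by blast
  moreover have "Im (cinner (R x) x) = 0 \<and> Re (cinner (R x) x) \<ge> 0" for x
  proof -
    have "cinner (R x) e * cinner e x = complex_of_real (c e * (cmod (cinner x e))\<^sup>2)" if "e \<in> E" for e
      using cinner_commute[of e x] by (simp add: R[OF that] complex_norm_square del: of_real_power)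
    then have s: "((\<lambda>e. complex_of_real (c e * (cmod (cinner x e))\<^sup>2)) has_sum cinner (R x) x) E"
      using parseval[OF E, of "R x" x] by (simp cong: has_sum_cong)
    have "((\<lambda>e. 0) has_sum Im (cinner (R x) x)) E" using has_sum_Im[OF s] by simp
    then have "Im (cinner (R x) x) = 0" using has_sum_0_simp has_sum_unique by blast
    moreover have "Re (cinner (R x) x) \<ge> 0"
      using has_sum_Re[OF s] by (rule has_sum_nonneg) (use c in simp)
    ultimately show ?thesis by simp
  qed
  ultimately show ?thesis using R unfolding positive_op_def by blast
qed

text \<open>The diagonal operator \<open>R\<close> with entries \<open>norm (S e)\<close> is a
  positive square root of S* S. Any positive square root \<open>Q\<close> has the same values on
  \<open>E\<close>, hence everywhere by expansion, so \<open>R\<close> is what the description in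
  \<open>abs_op\<close> denotes.\<close>

lemma abs_op_diagonal:
  fixes S :: "'a::chilbert \<Rightarrow> 'a"
  assumes S: "bounded_op S" and E: "onb E"
    and ev: "\<And>e. e \<in> E \<Longrightarrow> adjoint S (S e) = (norm (S e))\<^sup>2 *\<^sub>R e" and "e \<in> E"
  shows "cinner (abs_op S x) e = complex_of_real (norm (S e)) * cinner x e"
proof -
  note oE = onb_orthonormal[OF E]
  obtain K where K: "K > 0" "\<And>x. norm (S x) \<le> K * norm x" using bounded_op_pos_bound[OF S] by blast
  have "0 \<le> norm (S e) \<and> norm (S e) \<le> K" if "e \<in> E" for e
    using K(2)[of e] orthonormal_norm[OF oE that] by simp
  then obtain R where R: "positive_op R" and Re: "\<And>x e. e \<in> E \<Longrightarrow> cinner (R x) e = complex_of_real (norm (S e)) * cinner x e"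
    using diagonal_op_exists[OF E, of "\<lambda>e. norm (S e)" K] by blast
  have RR: "R (R x) = adjoint S (S x)" for x
  proof (rule onb_eqI[OF E])
    fix e assume e: "e \<in> E"
    have "cinner (adjoint S (S x)) e = cinner x (adjoint S (S e))"
      by (simp add: cinner_adjoint'[OF S] cinner_adjoint[OF S])
    then show "cinner (R (R x)) e = cinner (adjoint S (S x)) e"
      by (simp add: Re[OF e] ev[OF e] cinner_scaleR_right power2_eq_square)
  qed
  have "abs_op S = R"
    unfolding abs_op_def
  proof (rule the_equality)
    fix Q assume Q: "positive_op Q \<and> (\<forall>x. Q (Q x) = adjoint S (S x))"
    have eq: "Q e = R e" if e: "e \<in> E" for e
      using positive_op_sqrt_eigenvector[of Q "norm (S e)" e]
        positive_op_sqrt_eigenvector[of R "norm (S e)" e] Q R RR ev[OF e] by simp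
    have "bounded_op Q" "bounded_op R" using Q R by (auto simp: positive_op_def)
    have "Q x = R x" for x
    proof (rule has_sum_unique)
      show "((\<lambda>e. scaleC (cinner x e) (Q e)) has_sum Q x) E"
        by (rule bounded_op_expansion[OF E \<open>bounded_op Q\<close>])
      show "((\<lambda>e. scaleC (cinner x e) (Q e)) has_sum R x) E"
        using bounded_op_expansion[OF E \<open>bounded_op R\<close>, of x] eq by (simp cong: has_sum_cong)
    qed
    then show "Q = R" by blast
  qed (use R RR in blast)
  then show ?thesis using Re[OF \<open>e \<in> E\<close>] by simp
qed

text \<open>The set is the closed span of \<open>F\<close>. For an orthonormal \<open>B\<close> in
  it, count the squares |<b, e>|^2 twice: Parseval gives 1 for each \<open>b\<close>, Bessel at most
  1 for each \<open>e\<close> in \<open>F\<close>. If \<open>F\<close> is infinite, its own finite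
  subsets have unbounded size.\<close>

lemma hdim_span_onb:
  fixes E :: "'a::chilbert set"
  assumes E: "onb E" and F: "F \<subseteq> E"
  shows "hdim {x. \<forall>e\<in>E - F. cinner x e = 0} = (if finite F then of_nat (card F) else top)"
    (is "hdim ?V = _")
proof -
  note oE = onb_orthonormal[OF E]
  have FV: "F \<subseteq> ?V" using F orthonormal_cinner[OF oE] by auto
  have low: "of_nat (card B) \<le> hdim ?V" if "finite B" "B \<subseteq> F" for B
    unfolding hdim_def
    by (rule SUP_upper) (use that FV orthonormal_subset[OF oE, of B] F in auto)
  show ?thesis
  proof (cases "finite F")
    case True
    have "card B \<le> card F" if B: "finite B" "B \<subseteq> ?V" "orthonormal B" for B
    proof -
      have "(\<Sum>e\<in>F. (cmod (cinner b e))\<^sup>2) = 1" if b: "b \<in> B" for b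
      proof (rule has_sum_unique)
        show "((\<lambda>e. (cmod (cinner b e))\<^sup>2) has_sum (\<Sum>e\<in>F. (cmod (cinner b e))\<^sup>2)) E"
          using True F B(2) b by (intro has_sum_finite_neutralI[where B=F]) auto
        show "((\<lambda>e. (cmod (cinner b e))\<^sup>2) has_sum 1) E"
          using parseval_norm[OF E, of b] orthonormal_norm[OF B(3) b] by simp
      qed
      then have "real (card B) = (\<Sum>b\<in>B. \<Sum>e\<in>F. (cmod (cinner b e))\<^sup>2)" by simp
      also have "\<dots> = (\<Sum>e\<in>F. \<Sum>b\<in>B. (cmod (cinner e b))\<^sup>2)"
        by (subst sum.swap) (simp add: cmod_cinner_commute)
      also have "\<dots> \<le> (\<Sum>e\<in>F. (norm e)\<^sup>2)"
        by (intro sum_mono bessel_finite B)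
      also have "\<dots> = real (card F)"
        using orthonormal_norm[OF oE] F by (simp add: subset_iff)
      finally show ?thesis by simp
    qed
    then have "hdim ?V \<le> of_nat (card F)"
      unfolding hdim_def by (intro SUP_least) auto
    then show ?thesis using low[of F] True by (simp add: antisym)
  next
    case False
    have "hdim ?V = top"
    proof (rule ccontr)
      assume "hdim ?V \<noteq> top"
      then obtain n where n: "hdim ?V < of_nat n"
        using ennreal_Ex_less_of_nat[of "hdim ?V"] by (auto simp: top.not_eq_extremum)
      obtain B where "finite B" "card B = n" "B \<subseteq> F"
        using infinite_arbitrarily_large[OF False] by blast
      then show False using low[of B] n by simp
    qed
    then show ?thesis using False by simp
  qed
qed

section \<open>The Schatten sum over an eigenbasis\<close>

lemma ennreal_summable_on: "(f :: 'i \<Rightarrow> ennreal) summable_on A"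
  by (rule nonneg_summable_on_complete) simp

lemma finite_sum_le_infsum_ennreal:
  fixes f :: "'i \<Rightarrow> ennreal"
  assumes "finite F" "F \<subseteq> A"
  shows "sum f F \<le> infsum f A"
  by (subst nonneg_infsum_complete) (use assms in \<open>auto intro: SUP_upper\<close>)

text \<open>Group the basis into fibres \<open>G s\<close> of \<open>norm (S e)\<close>. As the
  modulus is diagonal, the eigenspace for \<open>s\<close> is the closed span of \<open>G s\<close>,
  so its dimension counts the basis vectors with that singular value. Later arguments can thus sum
  over a basis and avoid multiplicities.\<close>

theorem schatten_pow_eigenbasis:
  fixes S :: "'a::chilbert \<Rightarrow> 'a"
  assumes S: "bounded_op S" and E: "onb E"
    and ev: "\<And>e. e \<in> E \<Longrightarrow> adjoint S (S e) = (norm (S e))\<^sup>2 *\<^sub>R e"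
  shows "schatten_pow p S = (\<Sum>\<^sub>\<infinity>e\<in>E. ennreal (norm (S e) powr p))"
proof -
  note oE = onb_orthonormal[OF E]
  define G where "G s = {e\<in>E. norm (S e) = s}" for s
  define f where "f e = ennreal (norm (S e) powr p)" for e
  define g where "g s = hdim (eigenspace (abs_op S) (complex_of_real s)) * ennreal (s powr p)" for s
  have V: "eigenspace (abs_op S) (complex_of_real s) = {x. \<forall>e\<in>E - G s. cinner x e = 0}" for s
  proof -
    have "abs_op S x = scaleC (complex_of_real s) x \<longleftrightarrow> (\<forall>e\<in>E - G s. cinner x e = 0)" (is "?L = ?R") for x
    proof -
      have "?L \<longleftrightarrow> (\<forall>e\<in>E. cinner (abs_op S x) e = cinner (scaleC (complex_of_real s) x) e)"
        using onb_eqI[OF E, of "abs_op S x" "scaleC (complex_of_real s) x"] by auto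
      also have "\<dots> \<longleftrightarrow> ?R"
        unfolding G_def by (auto simp: abs_op_diagonal[OF S E ev] cinner_scaleC_left)
      finally show ?thesis .
    qed
    then show ?thesis unfolding eigenspace_def by simp
  qed
  have g: "g s = infsum f (G s)" if s: "s > 0" for s
  proof -
    have "infsum f (G s) = infsum (\<lambda>_. ennreal (s powr p)) (G s)"
      by (rule infsum_cong) (simp add: f_def G_def)
    moreover have "hdim (eigenspace (abs_op S) (complex_of_real s)) = (if finite (G s) then of_nat (card (G s)) else top)"
      unfolding V by (rule hdim_span_onb[OF E]) (auto simp: G_def)
    \<comment> \<open>An infinite fibre makes both sides infinite: the dimension is
      \<open>top\<close>, and infinitely many equal positive terms sum to
      \<open>top\<close>.\<close>
    moreover have "infsum (\<lambda>_. ennreal (s powr p)) (G s) = top" if "infinite (G s)"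
      using infsum_superconst_infinite_ennreal[OF _ _ that, of "ennreal (s powr p)" "\<lambda>_. ennreal (s powr p)"] s by simp
    ultimately show ?thesis using s by (simp add: g_def ennreal_top_mult)
  qed
  have sv: "s \<in> singular_value_set S" if "s > 0" "e \<in> G s" for s e
  proof -
    have "e \<in> E" using that by (simp add: G_def)
    then have "e \<in> eigenspace (abs_op S) (complex_of_real s)"
      unfolding V using that orthonormal_cinner[OF oE] by auto
    moreover have "e \<noteq> 0" using orthonormal_norm[OF oE \<open>e \<in> E\<close>] by auto
    ultimately show ?thesis using that(1) unfolding singular_value_set_def by blast
  qed
  have "infsum g (singular_value_set S) \<le> infsum f E"
  proof (rule infsum_le_finite_sums)
    fix X assume X: "finite X" "X \<subseteq> singular_value_set S"
    have "sum g X = (\<Sum>s\<in>X. infsum f (G s))"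
      using X by (intro sum.cong g) (auto simp: singular_value_set_def)
    also have "\<dots> = infsum f (\<Union>s\<in>X. G s)"
      by (rule sum_infsum[OF X(1)]) (auto simp: G_def ennreal_summable_on)
    also have "\<dots> \<le> infsum f E"
      by (rule infsum_mono_neutral) (auto simp: G_def ennreal_summable_on)
    finally show "sum g X \<le> infsum f E" .
  qed (rule ennreal_summable_on)
  moreover have "infsum f E \<le> infsum g (singular_value_set S)"
  proof (rule infsum_le_finite_sums)
    fix F assume F: "finite F" "F \<subseteq> E"
    \<comment> \<open>Vectors with \<open>S e = 0\<close> belong to no singular value; they
      contribute nothing because \<open>0 powr p = 0\<close>.\<close>
    define F' where "F' = {e\<in>F. norm (S e) > 0}"
    define X where "X = (\<lambda>e. norm (S e)) ` F'"
    have "sum f F = sum f F'"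
      by (rule sum.mono_neutral_right) (use F in \<open>auto simp: F'_def f_def\<close>)
    also have "\<dots> = (\<Sum>s\<in>X. sum f {e\<in>F'. norm (S e) = s})"
      unfolding X_def by (rule sum.image_gen) (use F in \<open>simp add: F'_def\<close>)
    also have "\<dots> \<le> (\<Sum>s\<in>X. g s)"
    proof (rule sum_mono)
      fix s assume "s \<in> X"
      then have "s > 0" by (auto simp: X_def F'_def)
      have "sum f {e\<in>F'. norm (S e) = s} \<le> infsum f (G s)"
        by (rule finite_sum_le_infsum_ennreal) (use F in \<open>auto simp: F'_def G_def\<close>)
      then show "sum f {e\<in>F'. norm (S e) = s} \<le> g s" using g[OF \<open>s > 0\<close>] by simp
    qed
    also have "\<dots> \<le> infsum g (singular_value_set S)"
    proof (rule finite_sum_le_infsum_ennreal)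
      show "X \<subseteq> singular_value_set S"
        using sv F unfolding X_def F'_def G_def by auto
    qed (use F in \<open>auto simp: X_def F'_def\<close>)
    finally show "sum f F \<le> infsum g (singular_value_set S)" .
  qed (rule ennreal_summable_on)
  ultimately show ?thesis
    unfolding schatten_pow_def f_def[symmetric] g_def[symmetric] by (rule antisym)
qed

section \<open>Schatten norms and diagonal sums\<close>

text \<open>Jensen's inequality for the normalised weights \<open>w i / W\<close>. Undoing the
  normalisation costs the factor \<open>W powr (p - 1)\<close>, which is monotone in
  \<open>W\<close>.\<close>

lemma weighted_power_mean:
  fixes \<sigma> w :: "'i \<Rightarrow> real"
  assumes "finite F" "\<And>i. i \<in> F \<Longrightarrow> 0 \<le> \<sigma> i" "\<And>i. i \<in> F \<Longrightarrow> 0 \<le> w i"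
    and C: "sum w F \<le> C" and p: "1 \<le> p"
  shows "(\<Sum>i\<in>F. \<sigma> i * w i) powr p \<le> C powr (p - 1) * (\<Sum>i\<in>F. \<sigma> i powr p * w i)"
proof -
  \<comment> \<open>Indices with \<open>\<sigma> i = 0\<close> contribute to neither side, so
    convexity is applied at positive arguments only.\<close>
  define F' where "F' = {i\<in>F. \<sigma> i > 0}"
  have F': "finite F'" "F' \<subseteq> F" using assms(1) by (auto simp: F'_def)
  have z: "\<sigma> i = 0" if "i \<in> F - F'" for i
    using that assms(2)[of i] by (auto simp: F'_def)
  have w0: "w i \<ge> 0" if "i \<in> F'" for i using that F' assms(3) by blast
  have s1: "(\<Sum>i\<in>F. \<sigma> i * w i) = (\<Sum>i\<in>F'. \<sigma> i * w i)"
    by (rule sum.mono_neutral_right) (use assms(1) F' z in auto)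
  have s2: "(\<Sum>i\<in>F. \<sigma> i powr p * w i) = (\<Sum>i\<in>F'. \<sigma> i powr p * w i)"
    by (rule sum.mono_neutral_right) (use assms(1) F' z in auto)
  define W where "W = sum w F'"
  have "W \<le> sum w F"
    unfolding W_def by (rule sum_mono2) (use assms F' in auto)
  then have WC: "W \<le> C" using C by simp
  have W0: "W \<ge> 0" unfolding W_def by (rule sum_nonneg) (rule w0)
  have R0: "(\<Sum>i\<in>F'. \<sigma> i powr p * w i) \<ge> 0" by (intro sum_nonneg mult_nonneg_nonneg w0) auto
  show ?thesis
  proof (cases "W = 0")
    case True
    then have "w i = 0" if "i \<in> F'" for i
      using that sum_nonneg_eq_0_iff[OF F'(1) w0] by (simp add: W_def)
    then show ?thesis unfolding s1 s2 by simp
  next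
    case False
    then have Wp: "W > 0" using W0 by simp
    then have ne: "F' \<noteq> {}" by (auto simp: W_def)
    define \<mu> where "\<mu> = (\<Sum>i\<in>F'. (w i / W) *\<^sub>R \<sigma> i)"
    have \<mu>0: "\<mu> \<ge> 0"
      unfolding \<mu>_def by (rule sum_nonneg) (use w0 Wp in \<open>auto simp: F'_def\<close>)
    have "\<mu> powr p \<le> (\<Sum>i\<in>F'. (w i / W) * (\<sigma> i powr p))"
      unfolding \<mu>_def
    proof (rule convex_on_sum[OF F'(1) ne powr_convex[OF p]])
      show "(\<Sum>i\<in>F'. w i / W) = 1" using Wp by (simp add: W_def flip: sum_divide_distrib)
    qed (use w0 Wp in \<open>auto simp: F'_def\<close>)
    also have "\<dots> = (\<Sum>i\<in>F'. \<sigma> i powr p * w i) / W"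
      by (simp add: sum_divide_distrib mult.commute)
    finally have m: "\<mu> powr p \<le> (\<Sum>i\<in>F'. \<sigma> i powr p * w i) / W" .
    have "(\<Sum>i\<in>F'. \<sigma> i * w i) = W * \<mu>"
      using Wp by (simp add: \<mu>_def sum_distrib_left mult.commute)
    then have "(\<Sum>i\<in>F'. \<sigma> i * w i) powr p = W powr p * \<mu> powr p"
      using W0 \<mu>0 by (simp add: powr_mult)
    also have "\<dots> \<le> W powr p * ((\<Sum>i\<in>F'. \<sigma> i powr p * w i) / W)"
      by (intro mult_left_mono m) simp
    also have "\<dots> = W powr (p - 1) * (\<Sum>i\<in>F'. \<sigma> i powr p * w i)"
      using Wp by (simp add: powr_diff)
    also have "\<dots> \<le> C powr (p - 1) * (\<Sum>i\<in>F'. \<sigma> i powr p * w i)"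
      using p W0 WC by (intro mult_right_mono powr_mono2 R0) auto
    finally show ?thesis unfolding s1 s2 .
  qed
qed

text \<open>Stated through finite subfamilies, so that one notion covers frames indexed by
  \<open>nat\<close> and families indexed by a basis, without convergence questions.\<close>

definition bessel_on :: "real \<Rightarrow> ('i \<Rightarrow> 'a::chilbert) \<Rightarrow> 'i set \<Rightarrow> bool" where
  "bessel_on C f N \<longleftrightarrow> (\<forall>F x. finite F \<longrightarrow> F \<subseteq> N \<longrightarrow> (\<Sum>n\<in>F. (cmod (cinner x (f n)))\<^sup>2) \<le> C * (norm x)\<^sup>2)"

lemma bessel_onD:
  "bessel_on C f N \<Longrightarrow> finite F \<Longrightarrow> F \<subseteq> N \<Longrightarrow> (\<Sum>n\<in>F. (cmod (cinner x (f n)))\<^sup>2) \<le> C * (norm x)\<^sup>2"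
  unfolding bessel_on_def by blast

text \<open>Test the Bessel inequality on \<open>f n\<close> itself.\<close>

lemma bessel_on_norm:
  assumes "bessel_on C f N" "n \<in> N" "C \<ge> 0"
  shows "(norm (f n))\<^sup>2 \<le> C"
proof (cases "f n = 0")
  case False
  have "(norm (f n))\<^sup>2 * (norm (f n))\<^sup>2 \<le> C * (norm (f n))\<^sup>2"
    using bessel_onD[OF assms(1), of "{n}" "f n"] assms(2)
    by (simp add: cinner_norm norm_power power2_eq_square[of "(norm (f n))\<^sup>2"])
  then show ?thesis by (rule mult_right_le_imp_le) (use False in simp)
qed (use assms in simp)

lemma bessel_on_orthonormal: "orthonormal E \<Longrightarrow> bessel_on 1 (\<lambda>e. e) E"
  unfolding bessel_on_def by (simp add: bessel_finite orthonormal_subset)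

text \<open>Convexity is applied to truncations of the expansion along \<open>E\<close> to finite
  sets \<open>F\<close>. The bound is uniform in \<open>F\<close> and passes to the limit because
  \<open>N\<close> is finite.\<close>

lemma diagonal_form_power_bound:
  fixes T :: "'a::chilbert \<Rightarrow> 'a" and f g :: "'i \<Rightarrow> 'a"
  assumes T: "bounded_op T" and E: "onb E"
    and Te: "\<And>e. e \<in> E \<Longrightarrow> T e = \<sigma> e *\<^sub>R v e" and \<sigma>: "\<And>e. e \<in> E \<Longrightarrow> 0 \<le> \<sigma> e"
    and v: "bessel_on 1 v E" and f: "bessel_on C f N" and g: "bessel_on C g N" and C: "0 \<le> C"
    and p: "1 \<le> p" and N: "finite N"
    and M: "\<And>F. finite F \<Longrightarrow> F \<subseteq> E \<Longrightarrow> (\<Sum>e\<in>F. \<sigma> e powr p) \<le> M"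
  shows "(\<Sum>n\<in>N. cmod (cinner (T (f n)) (g n)) powr p) \<le> C powr p * M"
proof -
  note oE = onb_orthonormal[OF E]
  define h where "h n e = cinner (f n) e * cinner (T e) (g n)" for n e
  define w where "w n e = ((cmod (cinner (f n) e))\<^sup>2 + (cmod (cinner (g n) (v e)))\<^sup>2) / 2" for n e
  have w0: "w n e \<ge> 0" for n e by (simp add: w_def)
  have hs: "((\<lambda>e. h n e) has_sum cinner (T (f n)) (g n)) E" for n
    using has_sum_bounded_linear[OF bounded_linear_cinner_left bounded_op_expansion[OF E T]]
    by (simp add: cinner_scaleC_left h_def)
  have hw: "cmod (h n e) \<le> \<sigma> e * w n e" if e: "e \<in> E" for n e
  proof -
    have "cmod (h n e) = \<sigma> e * (cmod (cinner (f n) e) * cmod (cinner (g n) (v e)))"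
      using \<sigma>[OF e] by (simp add: h_def Te[OF e] cinner_scaleR_left norm_mult cmod_cinner_commute[of "v e"])
    also have "\<dots> \<le> \<sigma> e * w n e"
    proof (rule mult_left_mono[OF _ \<sigma>[OF e]])
      show "cmod (cinner (f n) e) * cmod (cinner (g n) (v e)) \<le> w n e"
        using sum_squares_bound[of "cmod (cinner (f n) e)" "cmod (cinner (g n) (v e))"] by (simp add: w_def)
    qed
    finally show ?thesis .
  qed
  \<comment> \<open>Row sums: Bessel for \<open>E\<close> and for \<open>v\<close> gives the squared
    norms of \<open>f n\<close> and \<open>g n\<close>, each at most \<open>C\<close>.\<close>
  have row: "sum (w n) F \<le> C" if "n \<in> N" "finite F" "F \<subseteq> E" for n F
  proof -
    have "(\<Sum>e\<in>F. (cmod (cinner (f n) e))\<^sup>2) \<le> C"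
      using bessel_finite[OF that(2) orthonormal_subset[OF oE that(3)], of "f n"] bessel_on_norm[OF f that(1) C]
      by (rule order_trans)
    moreover have "(\<Sum>e\<in>F. (cmod (cinner (g n) (v e)))\<^sup>2) \<le> C"
      using bessel_onD[OF v that(2,3), of "g n"] bessel_on_norm[OF g that(1) C] by simp
    ultimately show ?thesis by (simp add: w_def sum.distrib flip: sum_divide_distrib)
  qed
  \<comment> \<open>Column sums: the Bessel bounds of \<open>f\<close> and \<open>g\<close> are
    tested on \<open>e\<close> and \<open>v e\<close>, vectors of norm at most 1.\<close>
  have col: "(\<Sum>n\<in>N. w n e) \<le> C" if e: "e \<in> E" for e
  proof -
    have "(\<Sum>n\<in>N. (cmod (cinner (f n) e))\<^sup>2) \<le> C"
      using bessel_onD[OF f N subset_refl, of e] orthonormal_norm[OF oE e]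
      by (simp add: cmod_cinner_commute[of e])
    moreover have "(\<Sum>n\<in>N. (cmod (cinner (g n) (v e)))\<^sup>2) \<le> C"
      using bessel_onD[OF g N subset_refl, of "v e"] mult_left_mono[OF bessel_on_norm[OF v e] C]
      by (simp add: cmod_cinner_commute[of "v e"])
    ultimately show ?thesis by (simp add: w_def sum.distrib flip: sum_divide_distrib)
  qed
  have fin: "(\<Sum>n\<in>N. cmod (sum (h n) F) powr p) \<le> C powr p * M" if F: "finite F" "F \<subseteq> E" for F
  proof -
    have FE: "e \<in> E" if "e \<in> F" for e using F that by blast
    have "(\<Sum>n\<in>N. cmod (sum (h n) F) powr p) \<le> (\<Sum>n\<in>N. C powr (p - 1) * (\<Sum>e\<in>F. \<sigma> e powr p * w n e))"
    proof (rule sum_mono)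
      fix n assume n: "n \<in> N"
      have "cmod (sum (h n) F) \<le> (\<Sum>e\<in>F. \<sigma> e * w n e)"
        by (rule sum_norm_le) (use hw FE in blast)
      then have "cmod (sum (h n) F) powr p \<le> (\<Sum>e\<in>F. \<sigma> e * w n e) powr p"
        using p by (intro powr_mono2) auto
      also have "\<dots> \<le> C powr (p - 1) * (\<Sum>e\<in>F. \<sigma> e powr p * w n e)"
        using \<sigma> FE w0 by (intro weighted_power_mean F row n p) auto
      finally show "cmod (sum (h n) F) powr p \<le> C powr (p - 1) * (\<Sum>e\<in>F. \<sigma> e powr p * w n e)" .
    qed
    also have "\<dots> = C powr (p - 1) * (\<Sum>e\<in>F. \<sigma> e powr p * (\<Sum>n\<in>N. w n e))"
      unfolding sum_distrib_left[symmetric] by (subst sum.swap) (simp add: sum_distrib_left)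
    also have "\<dots> \<le> C powr (p - 1) * (\<Sum>e\<in>F. \<sigma> e powr p * C)"
      by (intro mult_left_mono sum_mono col FE) auto
    \<comment> \<open>One factor \<open>C\<close> comes from the columns and
      \<open>C powr (p - 1)\<close> from convexity along the rows; together they make
      \<open>C powr p\<close>.\<close>
    also have "\<dots> = (C * C powr (p - 1)) * (\<Sum>e\<in>F. \<sigma> e powr p)"
      by (simp add: sum_distrib_left mult_ac)
    also have "\<dots> = C powr p * (\<Sum>e\<in>F. \<sigma> e powr p)"
      using powr_mult_base[OF C, of "p - 1"] by simp
    also have "\<dots> \<le> C powr p * M"
      by (intro mult_left_mono M F) auto
    finally show ?thesis .
  qed
  show ?thesis
  proof (rule tendsto_upperbound)
    show "((\<lambda>F. \<Sum>n\<in>N. cmod (sum (h n) F) powr p) \<longlongrightarrow> (\<Sum>n\<in>N. cmod (cinner (T (f n)) (g n)) powr p))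
        (finite_subsets_at_top E)"
    proof (intro tendsto_sum tendsto_powr' tendsto_norm tendsto_const)
      show "(sum (h n) \<longlongrightarrow> cinner (T (f n)) (g n)) (finite_subsets_at_top E)" for n
        using hs[of n] by (simp add: has_sum_def)
    qed (use p in auto)
    show "\<forall>\<^sub>F F in finite_subsets_at_top E. (\<Sum>n\<in>N. cmod (sum (h n) F) powr p) \<le> C powr p * M"
      using fin by (auto simp: eventually_finite_subsets_at_top)
  qed simp
qed

text \<open>Take an eigenbasis of S* S; the eigenvalue at a unit vector \<open>e\<close> is <S* S e,
  e>, the square of \<open>norm (S e)\<close>.\<close>

lemma singular_basis_exists:
  fixes S :: "'a::chilbert \<Rightarrow> 'a"
  assumes S: "seq_compact_op S"
  obtains E where "onb E" "\<And>e. e \<in> E \<Longrightarrow> adjoint S (S e) = (norm (S e))\<^sup>2 *\<^sub>R e"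
proof -
  have bS: "bounded_op S" using S by (simp add: seq_compact_op_def)
  have "seq_compact_op (\<lambda>x. adjoint S (S x))"
    by (rule seq_compact_op_comp[OF bounded_op_adjoint[OF bS] S])
  moreover have "self_adjoint (\<lambda>x. adjoint S (S x))"
    unfolding self_adjoint_def by (simp add: cinner_adjoint'[OF bS] cinner_adjoint[OF bS])
  ultimately obtain E \<beta> where E: "onb E" and \<beta>: "\<And>e. e \<in> E \<Longrightarrow> adjoint S (S e) = \<beta> e *\<^sub>R e"
    using compact_self_adjoint_eigenbasis by blast
  have "\<beta> e = (norm (S e))\<^sup>2" if e: "e \<in> E" for e
  proof -
    have "complex_of_real (\<beta> e) = cinner (adjoint S (S e)) e"
      using orthonormal_cinner[OF onb_orthonormal[OF E] e e] by (simp add: \<beta>[OF e] cinner_scaleR_left)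
    also have "\<dots> = complex_of_real ((norm (S e))\<^sup>2)"
      by (simp add: cinner_adjoint'[OF bS] cinner_norm)
    finally show ?thesis by (simp only: of_real_eq_iff)
  qed
  then show thesis using that E \<beta> by metis
qed

text \<open>Distinct basis vectors have orthogonal images, since <S i, S j> = <i, S* S j> and
  \<open>j\<close> is an eigenvector of S* S. The scaled images have norm 1, or are zero where
  \<open>S e = 0\<close>.\<close>

lemma bessel_on_singular_vectors:
  fixes S :: "'a::chilbert \<Rightarrow> 'a"
  assumes bS: "bounded_op S" and E: "onb E"
    and ev: "\<And>e. e \<in> E \<Longrightarrow> adjoint S (S e) = (norm (S e))\<^sup>2 *\<^sub>R e"
  shows "bessel_on 1 (\<lambda>e. (1 / norm (S e)) *\<^sub>R S e) E"
  unfolding bessel_on_def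
proof (intro allI impI)
  fix F x assume F: "finite F" "F \<subseteq> E"
  have "(\<Sum>e\<in>F. (cmod (cinner x ((1 / norm (S e)) *\<^sub>R S e)))\<^sup>2) \<le> (norm x)\<^sup>2"
  proof (rule bessel_family[OF F(1)])
    fix i j assume ij: "i \<in> F" "j \<in> F" "i \<noteq> j"
    then have E': "i \<in> E" "j \<in> E" using F by auto
    have "cinner (S i) (S j) = 0"
      using orthonormal_cinner[OF onb_orthonormal[OF E] E'] ij
      by (simp add: cinner_adjoint[OF bS] ev[OF E'(2)] cinner_scaleR_right)
    then show "cinner ((1 / norm (S i)) *\<^sub>R S i) ((1 / norm (S j)) *\<^sub>R S j) = 0"
      by (simp add: cinner_scaleR_left cinner_scaleR_right)
  qed simp
  then show "(\<Sum>e\<in>F. (cmod (cinner x ((1 / norm (S e)) *\<^sub>R S e)))\<^sup>2) \<le> 1 * (norm x)\<^sup>2" by simp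
qed

lemma finite_sum_le_of_infsum_ennreal:
  assumes "infsum (\<lambda>i. ennreal (f i)) A \<le> ennreal M" "0 \<le> M" "finite F" "F \<subseteq> A" "\<And>i. 0 \<le> f i"
  shows "sum f F \<le> M"
proof -
  have "ennreal (sum f F) = (\<Sum>i\<in>F. ennreal (f i))" using assms(5) by (simp add: sum_ennreal)
  also have "\<dots> \<le> infsum (\<lambda>i. ennreal (f i)) A"
    by (rule finite_sum_le_infsum_ennreal) (use assms in auto)
  also note assms(1)
  finally show ?thesis using assms(2) by (simp add: ennreal_le_iff)
qed

text \<open>The singular value decomposition of \<open>S\<close> supplies the diagonal data. The
  second family \<open>g\<close> serves the converse direction, where a singular basis is paired
  with its singular vectors.\<close>

theorem schatten_bessel_bound:
  fixes S :: "'a::chilbert \<Rightarrow> 'a" and f g :: "'i \<Rightarrow> 'a"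
  assumes S: "seq_compact_op S" and f: "bessel_on C f N" and g: "bessel_on C g N" and C: "0 \<le> C"
    and p: "1 \<le> p" and N: "finite N" and M: "schatten_pow p S \<le> ennreal M" "0 \<le> M"
  shows "(\<Sum>n\<in>N. cmod (cinner (S (f n)) (g n)) powr p) \<le> C powr p * M"
proof -
  have bS: "bounded_op S" using S by (simp add: seq_compact_op_def)
  obtain E where E: "onb E" and ev: "\<And>e. e \<in> E \<Longrightarrow> adjoint S (S e) = (norm (S e))\<^sup>2 *\<^sub>R e"
    using singular_basis_exists[OF S] by blast
  have Se: "S e = norm (S e) *\<^sub>R ((1 / norm (S e)) *\<^sub>R S e)" for e by simp
  show ?thesis
  proof (rule diagonal_form_power_bound[OF bS E Se _ bessel_on_singular_vectors[OF bS E ev] f g C p N])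
    show "(\<Sum>e\<in>F. norm (S e) powr p) \<le> M" if "finite F" "F \<subseteq> E" for F
      using that M by (intro finite_sum_le_of_infsum_ennreal[where A=E])
        (auto simp: schatten_pow_eigenbasis[OF bS E ev])
  qed auto
qed

lemma schatten_bessel_bound_ennreal:
  fixes S :: "'a::chilbert \<Rightarrow> 'a" and f :: "'i \<Rightarrow> 'a"
  assumes S: "seq_compact_op S" and f: "bessel_on 1 f N" and p: "1 \<le> p" and N: "finite N"
  shows "(\<Sum>n\<in>N. ennreal (cmod (cinner (S (f n)) (f n)) powr p)) \<le> schatten_pow p S"
proof (cases "schatten_pow p S" rule: ennreal_cases)
  case (real M)
  then show ?thesis
    using schatten_bessel_bound[OF S f f _ p N, of M] by (simp add: sum_ennreal ennreal_le_iff)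
qed simp

text \<open>An eigenbasis of \<open>S\<close> is one of S* S = S^2 too, and on it both
  \<open>norm (S e)\<close> and |<S e, e>| equal the modulus of the eigenvalue.\<close>

lemma self_adjoint_schatten_attained:
  fixes S :: "'a::chilbert \<Rightarrow> 'a"
  assumes S: "seq_compact_op S" and sa: "self_adjoint S"
  obtains E where "onb E" "schatten_pow p S = (\<Sum>\<^sub>\<infinity>e\<in>E. ennreal (cmod (cinner (S e) e) powr p))"
proof -
  have bS: "bounded_op S" using S by (simp add: seq_compact_op_def)
  obtain E \<alpha> where E: "onb E" and \<alpha>: "\<And>e. e \<in> E \<Longrightarrow> S e = \<alpha> e *\<^sub>R e"
    using compact_self_adjoint_eigenbasis[OF S sa] by blast
  note oE = onb_orthonormal[OF E]
  have adj: "adjoint S = S" using sa by (intro adjoint_eqI) (simp add: self_adjoint_def)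
  have n: "norm (S e) = \<bar>\<alpha> e\<bar>" "cmod (cinner (S e) e) = \<bar>\<alpha> e\<bar>" if "e \<in> E" for e
    using orthonormal_norm[OF oE that] orthonormal_cinner[OF oE that that]
    by (simp_all add: \<alpha>[OF that] cinner_scaleR_left)
  have "adjoint S (S e) = (norm (S e))\<^sup>2 *\<^sub>R e" if "e \<in> E" for e
    unfolding adj n(1)[OF that]
    using clinear_op_scaleR[of S "\<alpha> e" e] bS by (simp add: \<alpha>[OF that] bounded_op_def power2_eq_square)
  then have "schatten_pow p S = (\<Sum>\<^sub>\<infinity>e\<in>E. ennreal (norm (S e) powr p))"
    by (rule schatten_pow_eigenbasis[OF bS E])
  also have "\<dots> = (\<Sum>\<^sub>\<infinity>e\<in>E. ennreal (cmod (cinner (S e) e) powr p))"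
    by (rule infsum_cong) (simp add: n)
  finally show thesis using that E by blast
qed

section \<open>Countable bases as frames, and frame bounds\<close>

lemma orthonormal_countable:
  fixes E :: "'a::chilbert set"
  assumes "separable TYPE('a)" "orthonormal E"
  shows "countable E"
proof -
  obtain D :: "'a set" where D: "countable D" "closure D = UNIV"
    using assms(1) unfolding separable_def by blast
  \<comment> \<open>Radius 1/2 separates orthonormal vectors: two of them sharing an approximant
    would lie at distance below 1, but their squared distance is 2.\<close>
  have "\<exists>d\<in>D. dist d e < 1/2" for e
    using D(2) closure_approachable[of e D] by (metis UNIV_I half_gt_zero_iff zero_less_one)
  then obtain d where d: "\<And>e. d e \<in> D" "\<And>e. dist (d e) e < 1/2" by metis
  have "inj_on d E"
  proof (rule inj_onI, rule ccontr)
    fix e e' assume e: "e \<in> E" "e' \<in> E" "d e = d e'" "e \<noteq> e'"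
    have "dist e e' < 1"
      using d(2)[of e] d(2)[of e'] dist_triangle3[of e e' "d e"] e(3) by simp
    then have "(norm (e - e'))\<^sup>2 < 1" by (simp add: dist_norm power_less_one_iff abs_square_less_1)
    moreover have "(norm (e - e'))\<^sup>2 = 2"
      using e orthonormal_norm[OF assms(2)] orthonormal_cinner[OF assms(2) e(1,2)] by (simp add: norm_diff_sq)
    ultimately show False by simp
  qed
  then show ?thesis using D(1) d(1) by (meson countableI' countable_image_inj_on countable_subset image_subsetI)
qed

text \<open>Frames are indexed by all natural numbers, so a finite basis is padded with zero vectors.\<close>
definition padded_enumeration :: "'a::chilbert set \<Rightarrow> nat \<Rightarrow> 'a" where
  "padded_enumeration E n = (if n \<in> to_nat_on E ` E then from_nat_into E n else 0)"

text \<open>The padding indices contribute \<open>h 0 = 0\<close>; the others are a reindexing of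
  \<open>E\<close>.\<close>

lemma has_sum_padded_enumeration:
  assumes E: "countable E" and h: "h 0 = 0"
  shows "((\<lambda>n. h (padded_enumeration E n)) has_sum s) UNIV \<longleftrightarrow> (h has_sum s) E"
proof -
  have "((\<lambda>n. h (padded_enumeration E n)) has_sum s) UNIV \<longleftrightarrow>
      ((\<lambda>n. h (padded_enumeration E n)) has_sum s) (to_nat_on E ` E)"
    by (rule has_sum_cong_neutral) (auto simp: padded_enumeration_def h)
  also have "\<dots> \<longleftrightarrow> (((\<lambda>n. h (padded_enumeration E n)) \<circ> to_nat_on E) has_sum s) E"
    by (rule has_sum_reindex[OF inj_on_to_nat_on[OF E]])
  also have "\<dots> \<longleftrightarrow> (h has_sum s) E"
    by (rule has_sum_cong) (simp add: padded_enumeration_def E)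
  finally show ?thesis .
qed

lemma frame_padded_enumeration:
  assumes E: "onb E" and c: "countable E"
  shows "frame_bounds (padded_enumeration E) 1 1"
proof -
  have "(\<lambda>n. (cmod (cinner x (padded_enumeration E n)))\<^sup>2) sums (norm x)\<^sup>2" for x
    using has_sum_padded_enumeration[OF c, of "\<lambda>e. (cmod (cinner x e))\<^sup>2"] parseval_norm[OF E, of x]
    by (simp add: has_sum_imp_sums)
  then show ?thesis unfolding frame_bounds_def by (auto simp: sums_iff)
qed

lemma upper_frame_bound_le: "frame_bounds f C1 C2 \<Longrightarrow> upper_frame_bound f \<le> C2"
  unfolding upper_frame_bound_def
  by (rule cInf_lower) (auto intro!: bdd_belowI[where m=0] simp: frame_bounds_def)

lemma frame_bounds_bessel_on:
  assumes "frame_bounds f C1 C2"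
  shows "bessel_on C2 f UNIV"
  unfolding bessel_on_def
proof (intro allI impI)
  fix F :: "nat set" and x assume "finite F"
  then have "(\<Sum>n\<in>F. (cmod (cinner x (f n)))\<^sup>2) \<le> (\<Sum>n. (cmod (cinner x (f n)))\<^sup>2)"
    using assms by (intro sum_le_suminf) (auto simp: frame_bounds_def)
  also have "\<dots> \<le> C2 * (norm x)\<^sup>2" using assms by (simp add: frame_bounds_def)
  finally show "(\<Sum>n\<in>F. (cmod (cinner x (f n)))\<^sup>2) \<le> C2 * (norm x)\<^sup>2" .
qed

text \<open>Admissible bounds come arbitrarily close to the infimum, so the inequality holds with
  \<open>C + \<epsilon>\<close>; then let \<open>\<epsilon>\<close> tend to 0.\<close>

lemma upper_frame_bound_bessel_on:
  assumes "frame f" "upper_frame_bound f \<le> C"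
  shows "bessel_on C f UNIV"
  unfolding bessel_on_def
proof (intro allI impI)
  fix F :: "nat set" and x :: 'a assume F: "finite F" "F \<subseteq> UNIV"
  let ?t = "\<Sum>n\<in>F. (cmod (cinner x (f n)))\<^sup>2"
  have "?t \<le> (C + \<epsilon>) * (norm x)\<^sup>2" if "\<epsilon> > 0" for \<epsilon>
  proof -
    have "{C2. \<exists>C1. frame_bounds f C1 C2} \<noteq> {}" using assms(1) by (auto simp: frame_def)
    moreover have "Inf {C2. \<exists>C1. frame_bounds f C1 C2} < C + \<epsilon>"
      using assms(2) that by (simp add: upper_frame_bound_def)
    ultimately have "\<exists>C2\<in>{C2. \<exists>C1. frame_bounds f C1 C2}. C2 < C + \<epsilon>" by (rule cInf_lessD)
    then obtain C1 C2 where fb: "frame_bounds f C1 C2" and "C2 < C + \<epsilon>" by blast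
    then show ?thesis
      using bessel_onD[OF frame_bounds_bessel_on[OF fb] F, of x]
        mult_right_mono[of C2 "C + \<epsilon>" "(norm x)\<^sup>2"] by simp
  qed
  moreover have "((\<lambda>\<epsilon>. (C + \<epsilon>) * (norm x)\<^sup>2) \<longlongrightarrow> (C + 0) * (norm x)\<^sup>2) (at_right 0)"
    by (intro tendsto_intros)
  ultimately have "?t \<le> (C + 0) * (norm x)\<^sup>2"
    by (intro tendsto_lowerbound[where F="at_right (0::real)"]) (auto simp: eventually_at_filter)
  then show "?t \<le> C * (norm x)\<^sup>2" by simp
qed

section \<open>Implications between Schatten membership and diagonal summability\<close>

lemma schatten_finite_imp_frame_summable:
  fixes S :: "'a::chilbert \<Rightarrow> 'a"
  assumes S: "seq_compact_op S" and p: "1 \<le> p" and fin: "schatten_pow p S < top" and "frame f"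
  shows "summable (\<lambda>n. cmod (cinner (S (f n)) (f n)) powr p)"
proof -
  obtain C1 C where fb: "frame_bounds f C1 C" using \<open>frame f\<close> by (auto simp: frame_def)
  then have C: "C \<ge> 0" by (simp add: frame_bounds_def)
  obtain M where M: "schatten_pow p S = ennreal M" "M \<ge> 0"
    using fin by (cases "schatten_pow p S" rule: ennreal_cases) auto
  have b: "bessel_on C f UNIV" by (rule frame_bounds_bessel_on[OF fb])
  have "bessel_on C f {..<n}" for n using b unfolding bessel_on_def by blast
  then have "(\<Sum>i<n. cmod (cinner (S (f i)) (f i)) powr p) \<le> C powr p * M" for n
    using M by (intro schatten_bessel_bound[OF S _ _ C p]) auto
  then show ?thesis by (intro summableI_nonneg_bounded) auto
qed

lemma onb_summable_imp_schatten_finite: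
  fixes S :: "'a::chilbert \<Rightarrow> 'a"
  assumes S: "seq_compact_op S" and p: "1 \<le> p"
    and sum: "\<And>E. onb E \<Longrightarrow> (\<lambda>e. cmod (cinner (S e) e) powr p) summable_on E"
  shows "schatten_pow p S < top"
proof -
  have bS: "bounded_op S" using S by (simp add: seq_compact_op_def)
  note SA = seq_compact_op_adjoint[OF S]
  \<comment> \<open>The hypothesis on \<open>S\<close> is used at an eigenbasis of \<open>A\<close>:
    there the diagonal of \<open>A\<close> computes its Schatten sum and is dominated by the
    diagonal of \<open>S\<close>.\<close>
  have part: "\<exists>M\<ge>0. schatten_pow p A \<le> ennreal M"
    if A: "seq_compact_op A" "self_adjoint A" and le: "\<And>x. cmod (cinner (A x) x) \<le> cmod (cinner (S x) x)" for A
  proof -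
    obtain E where E: "onb E" and eq: "schatten_pow p A = (\<Sum>\<^sub>\<infinity>e\<in>E. ennreal (cmod (cinner (A e) e) powr p))"
      using self_adjoint_schatten_attained[OF A] by blast
    let ?M = "\<Sum>\<^sub>\<infinity>e\<in>E. cmod (cinner (S e) e) powr p"
    have "schatten_pow p A \<le> ennreal ?M"
      unfolding eq
    proof (rule infsum_le_finite_sums)
      fix F assume F: "finite F" "F \<subseteq> E"
      have "(\<Sum>e\<in>F. cmod (cinner (A e) e) powr p) \<le> (\<Sum>e\<in>F. cmod (cinner (S e) e) powr p)"
        using p by (intro sum_mono powr_mono2 le) auto
      also have "\<dots> \<le> ?M" by (rule finite_sum_le_infsum[OF sum[OF E] F]) simp
      finally show "(\<Sum>e\<in>F. ennreal (cmod (cinner (A e) e) powr p)) \<le> ennreal ?M"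
        by (simp add: sum_ennreal ennreal_leI)
    qed (rule ennreal_summable_on)
    then show ?thesis by (intro exI[of _ ?M]) (simp add: infsum_nonneg)
  qed
  define A where "A x = scaleC (1/2) (S x) + scaleC (1/2) (adjoint S x)" for x
  define B where "B x = scaleC (- \<i>/2) (S x) + scaleC (\<i>/2) (adjoint S x)" for x
  note adj = cinner_adjoint'[OF bS]
  have adjr: "cinner x (adjoint S y) = cinner (S x) y" for x y by (simp add: cinner_adjoint[OF bS])
  have A: "seq_compact_op A" unfolding A_def by (rule seq_compact_op_lincomb[OF S SA])
  have B: "seq_compact_op B" unfolding B_def by (rule seq_compact_op_lincomb[OF S SA])
  have saA: "self_adjoint A"
    unfolding self_adjoint_def A_def by (simp add: cinner_algebra adj adjr)
  have saB: "self_adjoint B"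
    unfolding self_adjoint_def B_def by (simp add: cinner_algebra adj adjr)
  have SAB: "S x = A x + scaleC \<i> (B x)" for x
    unfolding A_def B_def
    using scaleC_add_left[of "1/2" "1/2" "S x"] 
    by (simp add: scaleC_diff_right scaleC_scaleC scaleC_one scaleC_minus_left)
  have leA: "cmod (cinner (A x) x) \<le> cmod (cinner (S x) x)" for x
  proof -
    have "cinner (A x) x = complex_of_real (Re (cinner (S x) x))"
      using cinner_commute[of x "S x"] by (simp add: A_def cinner_algebra adj complex_eq_iff)
    then show ?thesis by (simp add: abs_Re_le_cmod)
  qed
  have leB: "cmod (cinner (B x) x) \<le> cmod (cinner (S x) x)" for x
  proof -
    have "cinner (B x) x = complex_of_real (Im (cinner (S x) x))"
      using cinner_commute[of x "S x"] by (simp add: B_def cinner_algebra adj complex_eq_iff)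
    then show ?thesis by (simp add: abs_Im_le_cmod)
  qed
  obtain MA where MA: "MA \<ge> 0" "schatten_pow p A \<le> ennreal MA" using part[OF A saA leA] by blast
  obtain MB where MB: "MB \<ge> 0" "schatten_pow p B \<le> ennreal MB" using part[OF B saB leB] by blast
  obtain E where E: "onb E" and ev: "\<And>e. e \<in> E \<Longrightarrow> adjoint S (S e) = (norm (S e))\<^sup>2 *\<^sub>R e"
    using singular_basis_exists[OF S] by blast
  define v where "v e = (1 / norm (S e)) *\<^sub>R S e" for e
  have v: "bessel_on 1 v E" unfolding v_def by (rule bessel_on_singular_vectors[OF bS E ev])
  have "(\<Sum>e\<in>F. ennreal (norm (S e) powr p)) \<le> ennreal (2 powr p * (MA + MB))"
    if F: "finite F" "F \<subseteq> E" for F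
  proof -
    have vF: "bessel_on 1 v F" using v F unfolding bessel_on_def by blast
    have eF: "bessel_on 1 (\<lambda>e. e) F"
      by (rule bessel_on_orthonormal[OF orthonormal_subset[OF onb_orthonormal[OF E] F(2)]])
    \<comment> \<open>The constant comes from a + b \<le> 2 max(a, b) together with max(a, b)^p
      \<le> a^p + b^p.\<close>
    have "norm (S e) powr p \<le> 2 powr p * (cmod (cinner (A e) (v e)) powr p + cmod (cinner (B e) (v e)) powr p)" for e
    proof -
      let ?a = "cmod (cinner (A e) (v e))" and ?b = "cmod (cinner (B e) (v e))"
      have "norm (S e) = cmod (cinner (S e) (v e))"
        by (simp add: v_def cinner_scaleR_right cinner_norm norm_mult norm_power power2_eq_square norm_divide)
      also have "\<dots> \<le> ?a + ?b"
        using norm_triangle_ineq[of "cinner (A e) (v e)" "\<i> * cinner (B e) (v e)"]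
        by (subst SAB) (simp add: cinner_add_left cinner_scaleC_left norm_mult)
      also have "\<dots> \<le> 2 * max ?a ?b" by simp
      finally have "norm (S e) powr p \<le> (2 * max ?a ?b) powr p"
        using p by (intro powr_mono2) auto
      also have "\<dots> = 2 powr p * max ?a ?b powr p" by (simp add: powr_mult)
      also have "\<dots> \<le> 2 powr p * (?a powr p + ?b powr p)"
        by (intro mult_left_mono) (auto simp: max_def)
      finally show ?thesis .
    qed
    then have "(\<Sum>e\<in>F. norm (S e) powr p)
        \<le> (\<Sum>e\<in>F. 2 powr p * (cmod (cinner (A e) (v e)) powr p + cmod (cinner (B e) (v e)) powr p))"
      by (rule sum_mono)
    also have "\<dots> = 2 powr p * ((\<Sum>e\<in>F. cmod (cinner (A e) (v e)) powr p) + (\<Sum>e\<in>F. cmod (cinner (B e) (v e)) powr p))"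
      by (simp add: sum_distrib_left[symmetric] sum.distrib)
    also have "\<dots> \<le> 2 powr p * (MA + MB)"
      using schatten_bessel_bound[OF A eF vF _ p F(1) MA(2,1)] schatten_bessel_bound[OF B eF vF _ p F(1) MB(2,1)]
      by (intro mult_left_mono add_mono) auto
    finally show ?thesis by (simp add: sum_ennreal ennreal_leI)
  qed
  then have "(\<Sum>\<^sub>\<infinity>e\<in>E. ennreal (norm (S e) powr p)) \<le> ennreal (2 powr p * (MA + MB))"
    by (rule infsum_le_finite_sums[OF ennreal_summable_on])
  then have "schatten_pow p S \<le> ennreal (2 powr p * (MA + MB))"
    by (simp add: schatten_pow_eigenbasis[OF bS E ev])
  then show ?thesis using ennreal_less_top le_less_trans by blast
qed

theorem theorem7:
  fixes S :: "'a::chilbert \<Rightarrow> 'a" and p :: real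
  assumes "separable TYPE('a)"
    and "1 \<le> p"
    and "compact_op S"
  shows "(in_Sp p S \<longleftrightarrow>
            (\<forall>E. onb E \<longrightarrow> (\<lambda>e. cmod (cinner (S e) e) powr p) summable_on E))
       \<and> (in_Sp p S \<longleftrightarrow>
            (\<forall>f. frame f \<longrightarrow> summable (\<lambda>n. cmod (cinner (S (f n)) (f n)) powr p)))
       \<and> (self_adjoint S \<longrightarrow>
         schatten_pow p S =
           (SUP E\<in>{E. onb E}. \<Sum>\<^sub>\<infinity>e\<in>E. ennreal (cmod (cinner (S e) e) powr p))
       \<and> schatten_pow p S =
           (SUP f\<in>{f. frame f \<and> upper_frame_bound f \<le> 1}.
              \<Sum>n. ennreal (cmod (cinner (S (f n)) (f n)) powr p)))"
proof -
  note p = \<open>1 \<le> p\<close>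
  have S: "seq_compact_op S" by (rule compact_op_seq_compact_op[OF assms(3)])
  \<comment> \<open>Needed so that the zero vectors padding a basis add nothing to the diagonal
    sums.\<close>
  have S0: "S 0 = 0"
    using assms(3) clinear_op_scaleR[of S 0 0] by (simp add: compact_op_def)
  have count: "countable E" if "onb E" for E :: "'a set"
    by (rule orthonormal_countable[OF assms(1) onb_orthonormal[OF that]])
  have enum: "frame (padded_enumeration E)" "upper_frame_bound (padded_enumeration E) \<le> 1"
    if "onb E" for E :: "'a set"
    using frame_padded_enumeration[OF that count[OF that]] upper_frame_bound_le by (auto simp: frame_def)
  define onb_sum where "onb_sum \<longleftrightarrow> (\<forall>E. onb E \<longrightarrow> (\<lambda>e. cmod (cinner (S e) e) powr p) summable_on E)"
  define frame_sum where "frame_sum \<longleftrightarrow> (\<forall>f. frame f \<longrightarrow> summable (\<lambda>n. cmod (cinner (S (f n)) (f n)) powr p))"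
  have ac: "in_Sp p S \<Longrightarrow> frame_sum"
    unfolding frame_sum_def in_Sp_def using schatten_finite_imp_frame_summable[OF S p] by blast
  have cb: "frame_sum \<Longrightarrow> onb_sum"
    unfolding onb_sum_def
  proof (intro allI impI)
    fix E :: "'a set" assume "frame_sum" and E: "onb E"
    let ?h = "\<lambda>x. cmod (cinner (S x) x) powr p"
    have "summable (\<lambda>n. ?h (padded_enumeration E n))"
      using \<open>frame_sum\<close> enum[OF E] unfolding frame_sum_def by blast
    then have "(\<lambda>n. ?h (padded_enumeration E n)) summable_on UNIV"
      by (subst summable_on_UNIV_nonneg_real_iff) auto
    then show "?h summable_on E"
      unfolding summable_on_def using has_sum_padded_enumeration[OF count[OF E], of ?h] by (simp add: S0)
  qed
  have ba: "onb_sum \<Longrightarrow> in_Sp p S"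
    unfolding onb_sum_def in_Sp_def using onb_summable_imp_schatten_finite[OF S p] assms(3) by blast
  have sup: "schatten_pow p S = (SUP E\<in>{E. onb E}. \<Sum>\<^sub>\<infinity>e\<in>E. ennreal (cmod (cinner (S e) e) powr p))
       \<and> schatten_pow p S = (SUP f\<in>{f. frame f \<and> upper_frame_bound f \<le> 1}.
              \<Sum>n. ennreal (cmod (cinner (S (f n)) (f n)) powr p))" if sa: "self_adjoint S"
  proof -
    let ?h = "\<lambda>x. ennreal (cmod (cinner (S x) x) powr p)"
    \<comment> \<open>One eigenbasis \<open>E0\<close> attains both suprema: as a basis, and after
      padding as a frame with bounds 1. The Bessel bound with constant 1 gives both upper
      estimates.\<close>
    obtain E0 where E0: "onb E0" and eq: "schatten_pow p S = infsum ?h E0"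
      using self_adjoint_schatten_attained[OF S sa] by blast
    have "(?h has_sum infsum ?h E0) E0" by (simp add: ennreal_summable_on)
    then have "(\<lambda>n. ?h (padded_enumeration E0 n)) sums infsum ?h E0"
      using has_sum_padded_enumeration[OF count[OF E0], of ?h] by (intro has_sum_imp_sums) (simp add: S0)
    then have eq': "schatten_pow p S = (\<Sum>n. ?h (padded_enumeration E0 n))"
      using eq by (simp add: sums_iff)
    have "infsum ?h E \<le> schatten_pow p S" if E: "onb E" for E
    proof (rule infsum_le_finite_sums)
      fix F assume F: "finite F" "F \<subseteq> E"
      have "orthonormal F" by (rule orthonormal_subset[OF onb_orthonormal[OF E] F(2)])
      then show "sum ?h F \<le> schatten_pow p S"
        by (intro schatten_bessel_bound_ennreal[OF S _ p F(1)] bessel_on_orthonormal)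
    qed (rule ennreal_summable_on)
    then have "schatten_pow p S = (SUP E\<in>{E. onb E}. infsum ?h E)"
      using E0 eq by (intro antisym SUP_least) (auto intro: SUP_upper2)
    moreover have "(\<Sum>n. ?h (f n)) \<le> schatten_pow p S" if "frame f" "upper_frame_bound f \<le> 1" for f
    proof (rule suminf_le_const)
      fix n
      have "bessel_on 1 f {..<n}"
        using upper_frame_bound_bessel_on[OF that] unfolding bessel_on_def by blast
      then show "(\<Sum>i<n. ?h (f i)) \<le> schatten_pow p S"
        by (intro schatten_bessel_bound_ennreal[OF S _ p]) auto
    qed simp
    then have "schatten_pow p S = (SUP f\<in>{f. frame f \<and> upper_frame_bound f \<le> 1}. \<Sum>n. ?h (f n))"
      using enum[OF E0] eq' by (intro antisym SUP_least) (auto intro: SUP_upper2)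
    ultimately show ?thesis by blast
  qed
  show ?thesis
    unfolding onb_sum_def[symmetric] frame_sum_def[symmetric] using ac cb ba sup by blast
qed

end
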